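(* For every integer $k\geq 3$ there exists a constant $c=c(k)>0$ such that for all sufficiently large even positive integers $n$ there exists an ordered matching $M^<$ on $n$ vertices with $\chi_<(M^<)=k$ satisfying \[ r_<(M^<,K_3^<) \geq c\left(\frac{n}{\log n}\right)^{4/3}. \]
   Context: An ordered graph $G^<$ is a graph together with a linear ordering of its vertex set. An ordered graph $G^<$ is an ordered subgraph of $H^<$ if $G$ is a subgraph of $H$ and the vertex ordering of $G$ is the restriction of that of $H$. An ordered matching is a $1$-regular ordered graph. $K_N^<$ denotes the complete graph on $[N]=\{1,\dots,N\}$ with the natural order. The ordered Ramsey number $r_<(G^<,H^<)$ is the smallest positive integer $N$ such that every red-blue coloring of the edges of $K_N^<$ contains a red copy of $G^<$ (an ordered subgraph isomorphic to $G^<$ as ordered graphs, all of whose edges are red) or a blue copy of $H^<$. The interval chromatic number $\chi_<(G^<)$ is the minimum number of intervals (sets of consecutive vertices) into which the vertex set can be partitioned so that no edge has both endpoints in the same interval. All logarithms are base 2. *)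

theory Defs
  imports Complex_Main "HOL-Library.Ramsey" "HOL-Library.Disjoint_Sets"
begin

text \<open>The vertex set is ordered by the order of its type. A finite ordered graph is
  determined up to isomorphism by the relative order of its vertices, so \<open>nat\<close> as vertex
  type covers all of them. Edges are 2-element sets of vertices.\<close>

record 'a ograph =
  verts :: "'a set"
  edges :: "'a set set"

definition ordered_graph :: "'a::linorder ograph \<Rightarrow> bool" where
  "ordered_graph G \<longleftrightarrow> finite (verts G) \<and> edges G \<subseteq> nsets (verts G) 2"

definition ordered_subgraph :: "'a::linorder ograph \<Rightarrow> 'a ograph \<Rightarrow> bool" where
  "ordered_subgraph G H \<longleftrightarrow>
     ordered_graph G \<and> ordered_graph H \<and> verts G \<subseteq> verts H \<and> edges G \<subseteq> edges H"

definition ordered_isomorphic :: "'a::linorder ograph \<Rightarrow> 'b::linorder ograph \<Rightarrow> bool" where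
  "ordered_isomorphic G H \<longleftrightarrow>
     (\<exists>f. bij_betw f (verts G) (verts H) \<and> strict_mono_on (verts G) f \<and>
          edges H = (\<lambda>e. f ` e) ` edges G)"

definition degree :: "'a ograph \<Rightarrow> 'a \<Rightarrow> nat" where
  "degree G v = card {e \<in> edges G. v \<in> e}"

definition ordered_matching :: "'a::linorder ograph \<Rightarrow> bool" where
  "ordered_matching M \<longleftrightarrow> ordered_graph M \<and> (\<forall>v\<in>verts M. degree M v = 1)"

definition complete_ograph :: "nat \<Rightarrow> nat ograph" where
  "complete_ograph N = \<lparr>verts = {1..N}, edges = nsets {1..N} 2\<rparr>"

datatype color = Red | Blue

definition has_mono_copy ::
    "nat \<Rightarrow> (nat set \<Rightarrow> color) \<Rightarrow> color \<Rightarrow> 'a::linorder ograph \<Rightarrow> bool" where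
  "has_mono_copy N \<chi> col G \<longleftrightarrow>
     (\<exists>F. ordered_subgraph F (complete_ograph N) \<and> ordered_isomorphic G F \<and>
          (\<forall>e\<in>edges F. \<chi> e = col))"

text \<open>A colouring assigns colours to all sets of numbers, but only its values on the edges of
  the complete graph matter. The minimum exists for finite \<open>G\<close> and \<open>H\<close> by Ramsey's theorem.\<close>

definition ordered_ramsey :: "'a::linorder ograph \<Rightarrow> 'b::linorder ograph \<Rightarrow> nat" where
  "ordered_ramsey G H =
     (LEAST N. N > 0 \<and> (\<forall>\<chi>. has_mono_copy N \<chi> Red G \<or> has_mono_copy N \<chi> Blue H))"

definition interval_in :: "'a::linorder set \<Rightarrow> 'a set \<Rightarrow> bool" where
  "interval_in V I \<longleftrightarrow> I \<subseteq> V \<and> (\<forall>x\<in>I. \<forall>z\<in>I. \<forall>y\<in>V. x \<le> y \<and> y \<le> z \<longrightarrow> y \<in> I)"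

definition interval_colouring :: "'a::linorder ograph \<Rightarrow> 'a set set \<Rightarrow> bool" where
  "interval_colouring G P \<longleftrightarrow>
     partition_on (verts G) P \<and> (\<forall>I\<in>P. interval_in (verts G) I) \<and>
     (\<forall>e\<in>edges G. \<forall>I\<in>P. \<not> e \<subseteq> I)"

definition interval_chromatic_number :: "'a::linorder ograph \<Rightarrow> nat" where
  "interval_chromatic_number G = (LEAST k. \<exists>P. interval_colouring G P \<and> card P = k)"

end

theory Submission
  imports Defs "HOL-Real_Asymp.Real_Asymp"
begin

text \<open>A random graph on \<open>[m]\<close> of density of order \<open>m powr (-1/2)\<close>, made triangle-free by removing a
  maximal edge-disjoint family of triangles, yields a graph \<open>H\<close> that has the expected number
  of edges, up to a constant, between any two sets of at least order \<open>sqrt m * ln m\<close> vertices. This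
  holds because many edge-disjoint triangles meeting a given set of pairs are as unlikely as a
  large deviation of the number of edges in it. Blow up every vertex of \<open>H\<close> to an interval of
  order \<open>m\<close> consecutive vertices and colour the edges of the blow-up blue: there is no blue
  triangle, and \<open>N\<close> has order \<open>m\<^sup>2\<close>.

  The matching joins two intervals, each cut into \<open>2 m\<close> bins of order \<open>n / m\<close> vertices, and a fixed
  proportion of the vertices of each bin on the left are sent to independent random bins on the
  right. An embedding into \<open>[N]\<close> maps all but \<open>m\<close> of the bins on each side into single blocks, and
  by the density of \<open>H\<close> a fixed assignment of bins to blocks avoids all blue pairs with
  probability at most \<open>exp (- \<delta> n / sqrt m)\<close>. There are \<open>exp (O (m ln m))\<close> assignments, so a union
  bound works for \<open>n\<close> of order \<open>m powr (3/2) * ln m\<close>, that is, \<open>m\<close> of order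
  \<open>(n / ln n) powr (2/3)\<close>. All probabilities are counts of functions between finite sets; the edge
  density is \<open>1/Q\<close>, an edge being drawn when its value in \<open>{..<Q}\<close> is 0.\<close>

section \<open>Counting functions\<close>

text \<open>Prescribing the values on \<open>W\<close> has probability
  \<open>1 / card B ^ card W\<close>; the multiplied form avoids a subtraction of naturals in the
  exponent.\<close>

lemma card_PiE_const_on:
  assumes "finite U" "finite B" "W \<subseteq> U" "b \<in> B"
  shows "card {g \<in> U \<rightarrow>\<^sub>E B. \<forall>w\<in>W. g w = b} * card B ^ card W = card B ^ card U"
proof -
  have "{g \<in> U \<rightarrow>\<^sub>E B. \<forall>w\<in>W. g w = b} = (\<Pi>\<^sub>E u\<in>U. if u \<in> W then {b} else B)"
    using assms by (fastforce simp: PiE_iff split: if_splits)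
  hence "card {g \<in> U \<rightarrow>\<^sub>E B. \<forall>w\<in>W. g w = b} = (\<Prod>u\<in>U. if u \<in> W then 1 else card B)"
    using assms(1) by (simp add: card_PiE if_distrib cong: if_cong)
  also have "\<dots> = card B ^ card (U - W)"
    using assms(1) by (simp add: prod.If_cases Diff_eq flip: Collect_neg_eq)
  finally show ?thesis
    using assms by (metis card_Diff_subset card_mono finite_subset le_add_diff_inverse2 power_add)
qed

text \<open>\<open>k ^ k / fact k\<close> is a single term of the exponential series at
  \<open>k\<close>.\<close>

lemma power_self_le_exp_fact: "real k ^ k \<le> exp (real k) * fact k"
proof -
  have "real k ^ k /\<^sub>R fact k \<le> (\<Sum>n. real k ^ n /\<^sub>R fact n)"
    using sum_le_suminf[OF summable_exp_generic[of "real k"], of "{k}"] by simp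
  thus ?thesis by (simp add: exp_def field_simps)
qed

lemma choose_le_exp_power:
  assumes "k > 0"
  shows "real (n choose k) \<le> (exp 1 * real n / real k) ^ k"
proof -
  have "real (n choose k) * real k ^ k \<le> real (n choose k) * (exp (real k) * fact k)"
    by (intro mult_left_mono power_self_le_exp_fact) auto
  also have "\<dots> = exp (real k) * real ((n choose k) * fact k)" by simp
  also have "\<dots> \<le> exp (real k) * real (n ^ k)"
    by (intro mult_left_mono, unfold of_nat_le_iff, rule binomial_fact_pow) auto
  finally show ?thesis
    using assms by (simp add: power_divide power_mult_distrib field_simps flip: exp_of_nat_mult)
qed

text \<open>Markov's inequality for \<open>(1/2) ^ card {e\<in>Z. g e = 0}\<close>.\<close>

lemma card_few_zeros_le:
  fixes Q :: nat
  assumes "finite U" "Z \<subseteq> U" "Q > 0"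
  shows "real (card {g \<in> U \<rightarrow>\<^sub>E {..<Q}. 4 * Q * card {e\<in>Z. g e = 0} \<le> card Z})
    \<le> real Q ^ card U * exp (- real (card Z) / (4 * real Q))"
    (is "real (card ?Bad) \<le> _")
proof -
  let ?z = "card Z" and ?u = "card U"
  \<comment> \<open>Each zero in \<open>Z\<close> costs a factor 1/2. The product over the
    coordinates then records the number of zeros, while its sum over all \<open>g\<close>
    factorises.\<close>
  define F :: "'a \<Rightarrow> nat \<Rightarrow> real" where "F = (\<lambda>e y. if e \<in> Z \<and> y = 0 then 1/2 else 1)"
  have finZ: "finite Z" using assms finite_subset by blast
  have fin: "finite (U \<rightarrow>\<^sub>E {..<Q})" using assms by (simp add: finite_PiE)
  have prodF: "(\<Prod>e\<in>U. F e (g e)) = (1/2) ^ card {e\<in>Z. g e = 0}" for g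
  proof -
    have "(\<Prod>e\<in>U. F e (g e)) = (\<Prod>e\<in>{e\<in>Z. g e = 0}. 1/2)"
      using assms by (intro prod.mono_neutral_cong_right) (auto simp: F_def)
    thus ?thesis by simp
  qed
  have low: "exp (- real ?z / (4 * real Q)) \<le> (\<Prod>e\<in>U. F e (g e))" if "g \<in> ?Bad" for g
  proof -
    let ?c = "card {e\<in>Z. g e = 0}"
    have "real (4 * Q * ?c) \<le> real ?z" using that by (simp only: of_nat_le_iff mem_Collect_eq)
    hence "- real ?z / (4 * real Q) \<le> - real ?c"
      using assms(3) by (simp add: field_simps)
    hence "exp (- real ?z / (4 * real Q)) \<le> exp (- real ?c)" by simp
    also have "\<dots> = (exp (-1)) ^ ?c" by (simp flip: exp_of_nat_mult)
    also have "\<dots> \<le> (1/2) ^ ?c"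
    proof (rule power_mono)
      have "(2::real) \<le> exp 1" using exp_ge_add_one_self[of 1] by simp
      thus "exp (-1) \<le> (1/2::real)" by (simp add: exp_minus field_simps)
    qed auto
    finally show ?thesis by (simp add: prodF)
  qed
  have sumF: "(\<Sum>y<Q. F e y) = (if e \<in> Z then real Q - 1/2 else real Q)" for e
  proof -
    have "{..<Q} = insert 0 {1..<Q}" using assms(3) by auto
    thus ?thesis using assms(3) by (simp add: F_def)
  qed
  have "real (card ?Bad) * exp (- real ?z / (4 * real Q))
      = (\<Sum>g\<in>?Bad. exp (- real ?z / (4 * real Q)))" by simp
  also have "\<dots> \<le> (\<Sum>g\<in>?Bad. \<Prod>e\<in>U. F e (g e))" by (rule sum_mono) (rule low)
  also have "\<dots> \<le> (\<Sum>g\<in>U \<rightarrow>\<^sub>E {..<Q}. \<Prod>e\<in>U. F e (g e))"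
    by (rule sum_mono2) (use fin in \<open>auto simp: prodF\<close>)
  also have "\<dots> = (\<Prod>e\<in>U. \<Sum>y<Q. F e y)"
    using assms by (subst prod_sum_PiE) auto
  \<comment> \<open>A coordinate in \<open>Z\<close> sums to
    \<open>Q - 1/2 = Q * (1 - 1 / (2 * Q))\<close>, and \<open>1 + t \<le> exp t\<close>.\<close>
  also have "\<dots> \<le> (\<Prod>e\<in>U. real Q * (if e \<in> Z then exp (- 1 / (2 * real Q)) else 1))"
  proof (rule prod_mono, safe)
    fix e
    have "1 + (- 1 / (2 * real Q)) \<le> exp (- 1 / (2 * real Q))" by (rule exp_ge_add_one_self)
    hence "real Q * (1 + (- 1 / (2 * real Q))) \<le> real Q * exp (- 1 / (2 * real Q))"
      by (rule mult_left_mono) auto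
    moreover have "real Q * (1 + (- 1 / (2 * real Q))) = real Q - 1/2"
      using assms(3) by (simp add: field_simps)
    ultimately show "(\<Sum>y<Q. F e y) \<le> real Q * (if e \<in> Z then exp (- 1 / (2 * real Q)) else 1)"
      by (auto simp: sumF)
  qed (use assms(3) in \<open>auto simp: sumF\<close>)
  also have "\<dots> = real Q ^ ?u * exp (- 1 / (2 * real Q)) ^ ?z"
    using assms by (simp add: prod.distrib prod.If_cases Int_absorb1)
  also have "\<dots> = real Q ^ ?u * exp (- real ?z / (2 * real Q))" by (simp flip: exp_of_nat_mult)
  \<comment> \<open>One half of the exponent cancels against the lower bound \<open>low\<close>; the
    other half is the claimed estimate.\<close>
  also have "\<dots> = real Q ^ ?u * exp (- real ?z / (4 * real Q)) * exp (- real ?z / (4 * real Q))"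
    by (simp add: mult.assoc flip: exp_add)
  finally show ?thesis by simp
qed

text \<open>Disjointness makes the \<open>k\<close> events independent: the triples cover
  \<open>3 * k\<close> elements, which are all zero with probability \<open>1 / Q ^ (3 * k)\<close>.
  A union bound over the \<open>k\<close>-subsets of \<open>\<T>\<close> finishes.\<close>

lemma card_disjoint_zero_family_le:
  assumes "finite U" "finite \<T>" "\<And>t. t \<in> \<T> \<Longrightarrow> t \<subseteq> U \<and> card t = 3" "k > 0" "Q > 0"
  shows "real (card {g \<in> U \<rightarrow>\<^sub>E {..<Q}. \<exists>F\<subseteq>\<T>. card F = k \<and> disjoint F \<and> (\<forall>e\<in>\<Union>F. g e = (0::nat))})
     \<le> real Q ^ card U * (exp 1 * real (card \<T>) / (real k * real Q ^ 3)) ^ k"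
    (is "real (card ?Bad) \<le> _")
proof -
  define \<F> where "\<F> = {F. F \<subseteq> \<T> \<and> card F = k \<and> disjoint F}"
  define G where "G = (\<lambda>F. {g \<in> U \<rightarrow>\<^sub>E {..<Q}. \<forall>e\<in>\<Union>F. g e = (0::nat)})"
  have fin: "finite (U \<rightarrow>\<^sub>E {..<Q})" using assms by (simp add: finite_PiE)
  have finF: "finite \<F>" unfolding \<F>_def using assms(2) by simp
  have "card \<F> \<le> card {F. F \<subseteq> \<T> \<and> card F = k}"
    unfolding \<F>_def using assms(2) by (intro card_mono) auto
  hence cF: "card \<F> \<le> card \<T> choose k" by (simp add: n_subsets assms(2))
  have G: "real (card (G F)) = real Q ^ card U / real Q ^ (3 * k)" if "F \<in> \<F>" for F
  proof -
    have F: "F \<subseteq> \<T>" "card F = k" "disjoint F" using that by (auto simp: \<F>_def)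
    have "card (\<Union>F) = sum card F"
      using F assms(1,3) by (intro card_Union_disjoint) (auto dest: finite_subset)
    also have "\<dots> = (\<Sum>t\<in>F. 3)" using F assms(3) by (intro sum.cong) auto
    finally have "card (\<Union>F) = 3 * k" using F by simp
    moreover have "\<Union>F \<subseteq> U" using F assms(3) by blast
    ultimately have "card (G F) * Q ^ (3 * k) = Q ^ card U"
      using card_PiE_const_on[of U "{..<Q}" "\<Union>F" 0] assms by (simp add: G_def)
    hence "real (card (G F)) * real Q ^ (3 * k) = real Q ^ card U"
      by (metis of_nat_mult of_nat_power)
    thus ?thesis using assms(5) by (simp add: field_simps)
  qed
  have "?Bad \<subseteq> (\<Union>F\<in>\<F>. G F)"
  proof
    fix g assume "g \<in> ?Bad"
    then obtain F where "F \<subseteq> \<T>" "card F = k" "disjoint F" "\<forall>e\<in>\<Union>F. g e = 0" "g \<in> U \<rightarrow>\<^sub>E {..<Q}"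
      by blast
    hence "F \<in> \<F>" "g \<in> G F" by (simp_all add: \<F>_def G_def)
    thus "g \<in> (\<Union>F\<in>\<F>. G F)" by (rule UN_I)
  qed
  moreover have "finite (\<Union>F\<in>\<F>. G F)"
    by (rule finite_subset[OF _ fin]) (auto simp: G_def)
  ultimately have "card ?Bad \<le> card (\<Union>F\<in>\<F>. G F)"
    by (intro card_mono)
  also have "\<dots> \<le> (\<Sum>F\<in>\<F>. card (G F))" by (rule card_UN_le[OF finF])
  finally have "real (card ?Bad) \<le> real (\<Sum>F\<in>\<F>. card (G F))"
    by (rule of_nat_mono)
  also have "\<dots> = (\<Sum>F\<in>\<F>. real (card (G F)))" by (rule of_nat_sum)
  also have "\<dots> = real (card \<F>) * (real Q ^ card U / real Q ^ (3 * k))" by (simp add: G)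
  also have "\<dots> \<le> real (card \<T> choose k) * (real Q ^ card U / real Q ^ (3 * k))"
    using cF by (intro mult_right_mono) auto
  also have "\<dots> \<le> (exp 1 * real (card \<T>) / real k) ^ k * (real Q ^ card U / real Q ^ (3 * k))"
    using choose_le_exp_power[OF assms(4)] by (intro mult_right_mono) auto
  also have "\<dots> = real Q ^ card U * (exp 1 * real (card \<T>) / (real k * real Q ^ 3)) ^ k"
    by (simp add: power_divide power_mult_distrib power_mult)
  finally show ?thesis .
qed

section \<open>A dense triangle-free graph\<close>

text \<open>A triangle is represented by the set of its three edges, so that edge-disjointness is
  \<open>disjoint\<close> and lying in a graph is inclusion.\<close>

definition triangles :: "'a set \<Rightarrow> 'a set set set" where
  "triangles V = (\<lambda>S. nsets S 2) ` nsets V 3"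

lemma card_nsets: "finite A \<Longrightarrow> card (nsets A k) = card A choose k"
proof -
  assume A: "finite A"
  hence "nsets A k = {B. B \<subseteq> A \<and> card B = k}" by (auto simp: nsets_def dest: finite_subset)
  thus ?thesis using n_subsets[OF A, of k] by simp
qed

lemma trianglesD:
  assumes "t \<in> triangles V"
  shows "t \<subseteq> nsets V 2" "card t = 3"
proof -
  obtain S where S: "S \<in> nsets V 3" "t = nsets S 2" using assms by (auto simp: triangles_def)
  show "t \<subseteq> nsets V 2" using S nsets_mono[of S V 2] by (auto simp: nsets_def)
  have "finite S" "card S = 3" using S by (auto simp: nsets_def)
  moreover have "(3 choose 2) = (3::nat)" by (simp add: eval_nat_numeral)
  ultimately show "card t = 3" using S by (simp add: card_nsets)
qed

lemma finite_triangles: "finite V \<Longrightarrow> finite (triangles V)"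
  by (simp add: triangles_def finite_imp_finite_nsets)

text \<open>A triangle through a given edge is determined by its third vertex.\<close>

lemma card_triangles_meeting_le:
  assumes "finite V" "Z \<subseteq> nsets V 2"
  shows "card {t \<in> triangles V. t \<inter> Z \<noteq> {}} \<le> card Z * card V"
proof -
  have finZ: "finite Z" using assms finite_imp_finite_nsets finite_subset by blast
  have "{t \<in> triangles V. t \<inter> Z \<noteq> {}} \<subseteq> (\<lambda>(e, v). nsets (insert v e) 2) ` (Z \<times> V)"
  proof
    fix t assume "t \<in> {t \<in> triangles V. t \<inter> Z \<noteq> {}}"
    then obtain e where t: "t \<in> triangles V" "e \<in> t" "e \<in> Z" by blast
    obtain S where S: "S \<in> nsets V 3" "t = nsets S 2" using t by (auto simp: triangles_def)
    have "e \<subseteq> S" "card e = 2" "finite S" "card S = 3" "S \<subseteq> V"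
      using t S by (auto simp: nsets_def)
    moreover from this have "card (S - e) = 1" by (simp add: card_Diff_subset rev_finite_subset)
    then obtain v where "S - e = {v}" by (auto simp: card_1_singleton_iff)
    ultimately have "S = insert v e" "v \<in> V" by auto
    thus "t \<in> (\<lambda>(e, v). nsets (insert v e) 2) ` (Z \<times> V)" using t S by force
  qed
  hence "card {t \<in> triangles V. t \<inter> Z \<noteq> {}} \<le> card (Z \<times> V)"
    using finZ assms(1) by (intro surj_card_le) auto
  thus ?thesis by (simp add: card_cartesian_product)
qed

text \<open>Take \<open>F\<close> maximal among the edge-disjoint families inside \<open>E\<close>:
  a triangle that survives the removal shares no edge with \<open>F\<close> and could be added to
  it.\<close>

lemma triangle_free_by_removal:
  assumes "finite V"
  obtains F where "F \<subseteq> triangles V" "disjoint F" "\<Union>F \<subseteq> E"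
    "\<And>t. t \<in> triangles V \<Longrightarrow> \<not> t \<subseteq> E - \<Union>F"
proof -
  define \<A> where "\<A> = {F. F \<subseteq> triangles V \<and> disjoint F \<and> \<Union>F \<subseteq> E}"
  have "finite \<A>" unfolding \<A>_def using finite_triangles[OF assms] by simp
  moreover have "{} \<in> \<A>" by (simp add: \<A>_def)
  ultimately obtain F where F: "F \<in> \<A>" "\<And>F'. F' \<in> \<A> \<Longrightarrow> F \<subseteq> F' \<Longrightarrow> F = F'"
    using finite_has_maximal2[of \<A>] by metis
  have "\<not> t \<subseteq> E - \<Union>F" if t: "t \<in> triangles V" for t
  proof
    assume sub: "t \<subseteq> E - \<Union>F"
    have "t \<noteq> {}" using trianglesD(2)[OF t] by auto
    hence "t \<notin> F" using sub by blast
    moreover have "insert t F \<in> \<A>"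
      using F(1) t sub by (auto simp: \<A>_def disjoint_def)
    ultimately show False using F(2)[of "insert t F"] by blast
  qed
  thus ?thesis using F(1) that[of F] by (auto simp: \<A>_def)
qed

text \<open>Ordered pairs are counted, so an edge inside the intersection of \<open>X\<close> and
  \<open>Y\<close> counts twice; in this form the counts can be summed with multiplicities.\<close>

definition edges_between :: "'a set set \<Rightarrow> 'a set \<Rightarrow> 'a set \<Rightarrow> nat" where
  "edges_between H X Y = card {(x, y) \<in> X \<times> Y. {x, y} \<in> H}"

definition pairs_between :: "'a set \<Rightarrow> 'a set \<Rightarrow> 'a set set" where
  "pairs_between X Y = {{x, y} | x y. x \<in> X \<and> y \<in> Y \<and> x \<noteq> y}"

text \<open>One factor 2 is lost to the diagonal, since \<open>card X\<close> is at most half of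
  \<open>card X * card Y\<close>, and another to the two orders of a pair.\<close>

lemma card_pairs_between_ge:
  assumes "finite X" "finite Y" "card Y \<ge> 2"
  shows "card X * card Y \<le> 4 * card (pairs_between X Y)"
proof -
  let ?P = "{(x, y) \<in> X \<times> Y. x \<noteq> y}" and ?Z = "pairs_between X Y"
  have finP: "finite ?P" using assms by (auto intro: finite_subset[of _ "X \<times> Y"])
  have Zim: "?Z = (\<lambda>(x, y). {x, y}) ` ?P" by (auto simp: pairs_between_def)
  hence finZ: "finite ?Z" using finP by simp
  have "X \<times> Y \<subseteq> ?P \<union> (\<lambda>x. (x, x)) ` X" by auto
  hence "card (X \<times> Y) \<le> card (?P \<union> (\<lambda>x. (x, x)) ` X)"
    using finP assms by (intro card_mono) auto
  also have "\<dots> \<le> card ?P + card X"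
    by (meson card_Un_le card_image_le assms(1) add_left_mono le_trans)
  finally have 1: "card X * card Y \<le> card ?P + card X" by (simp add: card_cartesian_product)
  have "?P \<subseteq> (\<Union>e\<in>?Z. {(x, y). x \<noteq> y \<and> {x, y} = e})" by (auto simp: pairs_between_def)
  moreover have fib: "finite {(x, y). x \<noteq> y \<and> {x, y} = e} \<and> card {(x, y). x \<noteq> y \<and> {x, y} = e} \<le> 2" if e: "e \<in> ?Z" for e
  proof -
    obtain a b where "e = {a, b}" using e by (auto simp: pairs_between_def)
    hence "{(x, y). x \<noteq> y \<and> {x, y} = e} \<subseteq> {(a, b), (b, a)}" by (auto simp: doubleton_eq_iff)
    moreover have "card {(a, b), (b, a)} \<le> 2" using card_length[of "[(a, b), (b, a)]"] by simp
    ultimately show ?thesis by (meson card_mono finite.emptyI finite.insertI finite_subset le_trans)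
  qed
  ultimately have "card ?P \<le> card (\<Union>e\<in>?Z. {(x, y). x \<noteq> y \<and> {x, y} = e})"
    using finZ by (intro card_mono) auto
  also have "\<dots> \<le> (\<Sum>e\<in>?Z. card {(x, y). x \<noteq> y \<and> {x, y} = e})" by (rule card_UN_le[OF finZ])
  also have "\<dots> \<le> (\<Sum>e\<in>?Z. 2)" using fib by (intro sum_mono) auto
  finally have 2: "card ?P \<le> 2 * card ?Z" by simp
  have "card X * 2 \<le> card X * card Y" using assms(3) by (rule mult_left_mono) auto
  with 1 2 show ?thesis by linarith
qed

lemma card_pairs_between_Int_le:
  assumes "finite X" "finite Y"
  shows "card (pairs_between X Y \<inter> H) \<le> edges_between H X Y"
proof -
  have "pairs_between X Y \<inter> H \<subseteq> (\<lambda>(x, y). {x, y}) ` {(x, y) \<in> X \<times> Y. {x, y} \<in> H}"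
    by (auto simp: pairs_between_def)
  moreover have "finite {(x, y) \<in> X \<times> Y. {x, y} \<in> H}"
    using assms by (auto intro: finite_subset[of _ "X \<times> Y"])
  ultimately show ?thesis unfolding edges_between_def by (rule surj_card_le[rotated])
qed

text \<open>In units of \<open>card Z / (32 * Q)\<close>: \<open>E\<close> has more than 8 units of
  pairs in \<open>Z\<close>. Fewer than one unit of removed triangles meets \<open>Z\<close>, each
  taking at most three pairs, so more than 5 units survive; 4 are claimed.\<close>

lemma card_Int_removal_ge:
  fixes Q :: nat
  assumes V: "finite V" and Z: "Z \<subseteq> nsets V 2" "Z \<noteq> {}" and Q: "Q > 0"
    and k: "k = nat \<lceil>real (card Z) / (32 * real Q)\<rceil>"
    and few: "\<not> 4 * Q * card (Z \<inter> E) \<le> card Z"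
    and tri: "\<not> (\<exists>F \<subseteq> {t \<in> triangles V. t \<inter> Z \<noteq> {}}. card F = k \<and> disjoint F \<and> \<Union>F \<subseteq> E)"
    and F: "F \<subseteq> triangles V" "disjoint F" "\<Union>F \<subseteq> E"
  shows "card Z \<le> 8 * Q * card (Z \<inter> (E - \<Union>F))"
proof -
  let ?F = "{t \<in> F. t \<inter> Z \<noteq> {}}"
  have finZ: "finite Z" using V Z finite_imp_finite_nsets finite_subset by blast
  have finF: "finite F" using finite_triangles[OF V] F finite_subset by blast
  \<comment> \<open>Any \<open>k\<close> members of \<open>F\<close> that meet \<open>Z\<close>
    would form a family excluded by \<open>tri\<close>.\<close>
  have "card ?F < k"
  proof (rule ccontr)
    assume "\<not> card ?F < k"
    then obtain F' where "F' \<subseteq> ?F" "card F' = k"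
      by (meson not_less obtain_subset_with_card_n)
    moreover from this have "disjoint F'" using F(2) by (auto simp: disjoint_def)
    ultimately show False using tri F by blast
  qed
  \<comment> \<open>An integer below the ceiling of a real number is below that number, so the
    rounding in \<open>k\<close> costs nothing.\<close>
  hence "real (card ?F) < real (card Z) / (32 * real Q)"
    unfolding k by linarith
  hence 1: "32 * real Q * real (card ?F) < real (card Z)" using Q by (simp add: field_simps)
  have "Z \<inter> E \<subseteq> (Z \<inter> (E - \<Union>F)) \<union> \<Union>?F" by blast
  moreover have fint: "finite t" if "t \<in> ?F" for t
    using that F trianglesD(2)[of t V] by (auto intro: card_ge_0_finite)
  ultimately have "card (Z \<inter> E) \<le> card ((Z \<inter> (E - \<Union>F)) \<union> \<Union>?F)"
    using finZ finF by (intro card_mono finite_UnI finite_Union) auto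
  also have "\<dots> \<le> card (Z \<inter> (E - \<Union>F)) + card (\<Union>?F)" by (rule card_Un_le)
  also have "card (\<Union>?F) \<le> (\<Sum>t\<in>?F. card t)" using card_Union_le_sum_card by blast
  also have "\<dots> = (\<Sum>t\<in>?F. 3)" using F trianglesD(2) by (intro sum.cong) auto
  also have "\<dots> = 3 * card ?F" by simp
  finally have "real Q * real (card (Z \<inter> E)) \<le> real Q * real (card (Z \<inter> (E - \<Union>F)) + 3 * card ?F)"
    by (intro mult_left_mono of_nat_mono) auto
  moreover have "real (card Z) < real (4 * Q * card (Z \<inter> E))" using few by (simp only: of_nat_less_iff not_le)
  ultimately have "real (card Z) \<le> real (8 * Q * card (Z \<inter> (E - \<Union>F)))"
    using 1 by (simp add: algebra_simps)
  thus ?thesis by (simp only: of_nat_le_iff)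
qed

section \<open>The union bound over pairs of large vertex sets\<close>

lemma sum_Pow_power_card:
  fixes y :: real
  assumes "finite A"
  shows "(\<Sum>X\<in>Pow A. y ^ card X) = (1 + y) ^ card A"
  using prod_add[OF assms, of "\<lambda>_. y" "\<lambda>_. 1"] by (simp only: prod_constant prod.neutral_const mult_1_right add.commute[of 1 y] power_one)

text \<open>The total failure probability of the random graph: every vertex of \<open>X\<close> and
  \<open>Y\<close> carries the weight \<open>1 / m ^ 2\<close>, nonempty sets sum to at most
  \<open>exp (1 / m) - 1\<close>, and the factor 2 stands for the two kinds of bad event.\<close>

lemma ramsey_graph_sum_bound:
  assumes "m \<ge> 4"
  shows "2 * ((1 + 1 / real m ^ 2) ^ m - 1) ^ 2 < (1::real)"
proof -
  have "(1 + 1 / real m ^ 2) ^ m \<le> exp (1 / real m ^ 2) ^ m"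
    by (intro power_mono exp_ge_add_one_self) auto
  also have "\<dots> = exp (1 / real m)"
    using assms by (simp add: power2_eq_square flip: exp_of_nat_mult)
  also have "\<dots> \<le> exp (1 / 4)" using assms by (simp add: field_simps)
  also have "\<dots> \<le> 1 + 1/4 + (1/4)^2" by (rule exp_bound) auto
  finally have "(1 + 1 / real m ^ 2) ^ m - 1 \<le> 1/2" by (simp add: power2_eq_square)
  moreover have "0 \<le> (1 + 1 / real m ^ 2) ^ m - 1" by (simp add: one_le_power)
  ultimately have "((1 + 1 / real m ^ 2) ^ m - 1) ^ 2 \<le> (1/2) ^ 2" by (intro power_mono)
  thus ?thesis by (simp add: power2_eq_square)
qed

text \<open>The bad events for a pair \<open>X\<close>, \<open>Y\<close> are too few edges among its
  pairs \<open>Z\<close>, and too many disjoint triangles meeting \<open>Z\<close>. The bound on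
  \<open>Q\<close> keeps the expected number of such triangles, at most
  \<open>card Z * m / Q ^ 3\<close>, far below the expected \<open>card Z / Q\<close> edges. The
  bound on \<open>s\<close> makes each event have probability at most
  \<open>(1 / m ^ 2) ^ (card X + card Y)\<close>, which outweighs the number of choices of
  \<open>X\<close> and \<open>Y\<close>.\<close>

lemma exists_triangle_free_dense:
  fixes m Q :: nat and s :: real
  assumes m: "m \<ge> 4" and Q: "2 ^ 20 * m \<le> Q ^ 2" and s: "s \<ge> 64 * real Q * ln (real m)"
  obtains H where "H \<subseteq> nsets {..<m} 2" "\<And>t. t \<in> triangles {..<m} \<Longrightarrow> \<not> t \<subseteq> H"
    "\<And>X Y. X \<subseteq> {..<m} \<Longrightarrow> Y \<subseteq> {..<m} \<Longrightarrow> s \<le> real (card X) \<Longrightarrow> s \<le> real (card Y)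
       \<Longrightarrow> card X * card Y \<le> 32 * Q * edges_between H X Y"
proof -
  define V where "V = {..<m}"
  define U where "U = nsets V 2"
  define \<Omega> where "\<Omega> = U \<rightarrow>\<^sub>E {..<Q}"
  define k where "k = (\<lambda>Z::nat set set. nat \<lceil>real (card Z) / (32 * real Q)\<rceil>)"
  define Few where "Few = (\<lambda>Z. {g \<in> \<Omega>. 4 * Q * card {e\<in>Z. g e = 0} \<le> card Z})"
  define Tri where "Tri = (\<lambda>Z. {g \<in> \<Omega>. \<exists>F\<subseteq>{t \<in> triangles V. t \<inter> Z \<noteq> {}}.
                         card F = k Z \<and> disjoint F \<and> (\<forall>e\<in>\<Union>F. g e = 0)})"
  define S where "S = {X \<in> Pow V. s \<le> real (card X)}"
  have Q0: "Q > 0" using Q m by (cases "Q = 0") auto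
  have finV: "finite V" and cV: "card V = m" by (simp_all add: V_def)
  have finU: "finite U" using finV by (simp add: U_def finite_imp_finite_nsets)
  have fin\<Omega>: "finite \<Omega>" using finU by (simp add: \<Omega>_def finite_PiE)
  have c\<Omega>: "real (card \<Omega>) = real Q ^ card U" using finU by (simp add: \<Omega>_def card_PiE)
  have finS: "finite S" using finV by (simp add: S_def)
  have lnm: "ln (real m) \<ge> 1"
  proof -
    have "exp 1 \<le> (3::real)" using exp_le by simp
    hence "exp 1 \<le> real m" using m by linarith
    thus ?thesis using m by (simp add: ln_ge_iff)
  qed
  \<comment> \<open>Sets of size at least \<open>s\<close> thus contain a pair, and the empty set is
    not in \<open>S\<close>.\<close>
  have s2: "s \<ge> 2"
  proof -
    have "64 * 1 * 1 \<le> 64 * real Q * ln (real m)" using Q0 lnm by (intro mult_mono) auto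
    thus ?thesis using s by linarith
  qed
  have FewU: "real (card (Few Z)) \<le> real Q ^ card U * exp (- real (card Z) / (4 * real Q))" if "Z \<subseteq> U" for Z
    unfolding Few_def \<Omega>_def using card_few_zeros_le[OF finU that Q0] .
  have TriU: "real (card (Tri Z)) \<le> real Q ^ card U * exp (- real (card Z) / (4 * real Q))"
    if Z: "Z \<subseteq> U" "Z \<noteq> {}" for Z
  proof -
    let ?T = "{t \<in> triangles V. t \<inter> Z \<noteq> {}}" and ?k = "k Z"
    have finZ: "finite Z" using Z finU finite_subset by blast
    hence z0: "card Z > 0" using Z by (simp add: card_gt_0_iff)
    have kge: "real (card Z) / (32 * real Q) \<le> real ?k" unfolding k_def by linarith
    have k0: "?k > 0" using z0 Q0 by (simp add: k_def)
    have finT: "finite ?T" using finite_triangles[OF finV] by simp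
    have T: "t \<subseteq> U \<and> card t = 3" if "t \<in> ?T" for t
      using trianglesD[of t V] that unfolding U_def by blast
    have "real (card (Tri Z)) \<le> real Q ^ card U * (exp 1 * real (card ?T) / (real ?k * real Q ^ 3)) ^ ?k"
      unfolding Tri_def \<Omega>_def using card_disjoint_zero_family_le[OF finU finT T k0 Q0] .
    \<comment> \<open>The base is at most
      \<open>96 * m / Q ^ 2 \<le> 96 / 2 ^ 20 \<le> exp (- 8)\<close>. As
      \<open>?k \<ge> card Z / (32 * Q)\<close>, the exponent \<open>8 * ?k\<close> reaches
      \<open>card Z / (4 * Q)\<close>, the same as for \<open>Few\<close>.\<close>
    also have "\<dots> \<le> real Q ^ card U * exp (- 8) ^ ?k"
    proof (intro mult_left_mono power_mono)
      have "card ?T \<le> card Z * m"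
        using card_triangles_meeting_le[OF finV, of Z] Z cV by (simp add: U_def)
      hence "real (card ?T) \<le> real (card Z * m)" by (rule of_nat_mono)
      also have "\<dots> = real (card Z) * real m" by (rule of_nat_mult)
      also have "real (card Z) * real m \<le> (32 * real Q * real ?k) * real m"
        using kge Q0 by (intro mult_right_mono) (auto simp: field_simps)
      finally have "exp 1 * real (card ?T) \<le> 3 * ((32 * real Q * real ?k) * real m)"
        using exp_le by (intro mult_mono) auto
      moreover have "real (2 ^ 20 * m) \<le> real (Q ^ 2)" using Q by (simp only: of_nat_le_iff)
      hence "real m \<le> real Q ^ 2 / 2^20" by simp
      hence "3 * ((32 * real Q * real ?k) * real m) \<le> 3 * ((32 * real Q * real ?k) * (real Q ^ 2 / 2^20))"
        by (intro mult_left_mono) auto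
      ultimately have "exp 1 * real (card ?T) \<le> (96 / 2 ^ 20) * (real ?k * real Q ^ 3)"
        by (simp add: power2_eq_square power3_eq_cube mult_ac)
      hence "exp 1 * real (card ?T) / (real ?k * real Q ^ 3) \<le> 96 / 2 ^ 20"
        using k0 Q0 by (simp add: pos_divide_le_eq)
      also have "(96 / 2 ^ 20 :: real) \<le> exp (-8)"
      proof -
        have "exp 8 \<le> (3::real) ^ 8"
          using power_mono[OF exp_le, of 8] by (simp flip: exp_of_nat_mult)
        thus ?thesis by (simp add: exp_minus field_simps)
      qed
      finally show "exp 1 * real (card ?T) / (real ?k * real Q ^ 3) \<le> exp (-8)" .
    qed auto
    also have "\<dots> = real Q ^ card U * exp (- 8 * real ?k)" by (simp add: mult.commute flip: exp_of_nat_mult)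
    also have "\<dots> \<le> real Q ^ card U * exp (- real (card Z) / (4 * real Q))"
      using kge by (intro mult_left_mono) auto
    finally show ?thesis .
  qed
  have pair: "pairs_between X Y \<subseteq> U" "pairs_between X Y \<noteq> {}"
      "real (card X) * real (card Y) \<le> 4 * real (card (pairs_between X Y))"
    if XY: "X \<in> S" "Y \<in> S" for X Y
  proof -
    have f: "finite X" "finite Y" "X \<subseteq> V" "Y \<subseteq> V"
      using XY finV by (auto simp: S_def intro: finite_subset)
    have ge: "card X \<ge> 2" "card Y \<ge> 2" using XY s2 by (auto simp: S_def)
    show "pairs_between X Y \<subseteq> U" using f by (auto simp: pairs_between_def U_def)
    have le: "card X * card Y \<le> 4 * card (pairs_between X Y)"
      by (rule card_pairs_between_ge[OF f(1,2) ge(2)])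
    have "card X * card Y > 0" using ge by simp
    thus "pairs_between X Y \<noteq> {}" using le by auto
    show "real (card X) * real (card Y) \<le> 4 * real (card (pairs_between X Y))"
      using of_nat_mono[OF le, where 'a = real] by simp
  qed
  let ?y = "1 / real m ^ 2" and ?q = "real Q ^ card U"
  define Bad where "Bad = (\<Union>(X, Y)\<in>S \<times> S. Few (pairs_between X Y) \<union> Tri (pairs_between X Y))"
  have one: "real (card (Few (pairs_between X Y) \<union> Tri (pairs_between X Y)))
      \<le> 2 * ?q * (?y ^ card X * ?y ^ card Y)" if XY: "X \<in> S" "Y \<in> S" for X Y
  proof -
    let ?Z = "pairs_between X Y"
    have sXY: "s \<le> real (card X)" "s \<le> real (card Y)" using XY by (auto simp: S_def)
    \<comment> \<open>Both sizes are at least \<open>s\<close>, so their product dominates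
      \<open>s\<close> times their sum: one exponent pays for the choice of both sets.\<close>
    have "s * (real (card X) + real (card Y)) \<le> 2 * (real (card X) * real (card Y))"
      using sXY mult_right_mono[OF sXY(2), of "real (card X)"] mult_right_mono[OF sXY(1), of "real (card Y)"]
      by (simp add: algebra_simps)
    moreover have "64 * real Q * ln (real m) * (real (card X) + real (card Y)) \<le> s * (real (card X) + real (card Y))"
      using s by (intro mult_right_mono) auto
    ultimately have "64 * real Q * ln (real m) * (real (card X) + real (card Y)) \<le> 8 * real (card ?Z)"
      using pair(3)[OF XY] by linarith
    hence "2 * ln (real m) * (real (card X) + real (card Y)) \<le> real (card ?Z) / (4 * real Q)"
      using Q0 by (simp add: field_simps)
    hence "exp (- real (card ?Z) / (4 * real Q)) \<le> exp (- (2 * ln (real m) * (real (card X) + real (card Y))))"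
      by simp
    also have "\<dots> = exp (- (2 * ln (real m))) ^ (card X + card Y)"
      by (simp add: algebra_simps flip: exp_of_nat_mult)
    also have "exp (- (2 * ln (real m))) = ?y"
      using m by (simp add: exp_minus exp_double inverse_eq_divide)
    finally have e: "exp (- real (card ?Z) / (4 * real Q)) \<le> ?y ^ card X * ?y ^ card Y"
      by (simp add: power_add)
    have "real (card (Few ?Z \<union> Tri ?Z)) \<le> real (card (Few ?Z)) + real (card (Tri ?Z))"
      using card_Un_le[of "Few ?Z" "Tri ?Z"] by linarith
    also have "\<dots> \<le> 2 * ?q * exp (- real (card ?Z) / (4 * real Q))"
      using FewU[OF pair(1)[OF XY]] TriU[OF pair(1,2)[OF XY]] by linarith
    also have "\<dots> \<le> 2 * ?q * (?y ^ card X * ?y ^ card Y)" using e by (intro mult_left_mono) auto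
    finally show ?thesis .
  qed
  have "card Bad \<le> (\<Sum>(X, Y)\<in>S \<times> S. card (Few (pairs_between X Y) \<union> Tri (pairs_between X Y)))"
    unfolding Bad_def case_prod_unfold using finS by (intro card_UN_le) auto
  hence "real (card Bad) \<le> (\<Sum>(X, Y)\<in>S \<times> S. real (card (Few (pairs_between X Y) \<union> Tri (pairs_between X Y))))"
    by (simp add: case_prod_unfold flip: of_nat_sum)
  also have "\<dots> \<le> (\<Sum>(X, Y)\<in>S \<times> S. 2 * ?q * (?y ^ card X * ?y ^ card Y))"
    using one by (intro sum_mono) auto
  also have "\<dots> = 2 * ?q * (\<Sum>X\<in>S. ?y ^ card X) ^ 2"
  proof -
    have "(\<Sum>(X, Y)\<in>S \<times> S. ?y ^ card X * ?y ^ card Y) = (\<Sum>X\<in>S. ?y ^ card X) ^ 2"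
      unfolding power2_eq_square sum_product sum.cartesian_product ..
    thus ?thesis unfolding sum_distrib_left case_prod_unfold by (simp flip: sum_distrib_left)
  qed
  also have "\<dots> \<le> 2 * ?q * ((1 + ?y) ^ m - 1) ^ 2"
  proof (intro mult_left_mono power_mono)
    \<comment> \<open>Leaving out the empty set removes the leading 1 of the binomial sum, without
      which the total could not fall below 1.\<close>
    have "{} \<notin> S" using s2 by (simp add: S_def)
    hence "(\<Sum>X\<in>S. ?y ^ card X) \<le> (\<Sum>X\<in>Pow V - {{}}. ?y ^ card X)"
      using finV by (intro sum_mono2) (auto simp: S_def)
    also have "\<dots> = (1 + ?y) ^ m - 1"
      using sum_Pow_power_card[OF finV, of ?y] finV cV by (simp add: sum_diff1)
    finally show "(\<Sum>X\<in>S. ?y ^ card X) \<le> (1 + ?y) ^ m - 1" .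
  qed (auto intro: sum_nonneg)
  also have "\<dots> = ?q * (2 * ((1 + ?y) ^ m - 1) ^ 2)" by simp
  also have "\<dots> < ?q * 1"
    using ramsey_graph_sum_bound[OF m] Q0 by (intro mult_strict_left_mono) auto
  finally have "card Bad < card \<Omega>" using c\<Omega> by simp
  moreover have "Bad \<subseteq> \<Omega>" by (auto simp: Bad_def Few_def Tri_def)
  ultimately obtain g where g: "g \<in> \<Omega>" "g \<notin> Bad" by (metis less_irrefl subsetI subset_antisym)
  define E where "E = {e \<in> U. g e = 0}"
  obtain F where F: "F \<subseteq> triangles V" "disjoint F" "\<Union>F \<subseteq> E"
    "\<And>t. t \<in> triangles V \<Longrightarrow> \<not> t \<subseteq> E - \<Union>F"
    using triangle_free_by_removal[OF finV] by blast
  show ?thesis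
  proof (rule that[of "E - \<Union>F"])
    show "E - \<Union>F \<subseteq> nsets {..<m} 2" by (auto simp: E_def U_def V_def)
    show "\<not> t \<subseteq> E - \<Union>F" if "t \<in> triangles {..<m}" for t using F(4) that by (simp add: V_def)
    fix X Y assume XY: "X \<subseteq> {..<m}" "Y \<subseteq> {..<m}" "s \<le> real (card X)" "s \<le> real (card Y)"
    let ?Z = "pairs_between X Y"
    have S: "X \<in> S" "Y \<in> S" using XY by (auto simp: S_def V_def)
    have ng: "g \<notin> Few ?Z" "g \<notin> Tri ?Z" using g(2) S unfolding Bad_def by blast+
    have ZE: "{e \<in> ?Z. g e = 0} = ?Z \<inter> E" using pair(1)[OF S] by (auto simp: E_def)
    have few: "\<not> 4 * Q * card (?Z \<inter> E) \<le> card ?Z" using ng(1) g(1) by (simp add: Few_def ZE)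
    have tri: "\<not> (\<exists>F\<subseteq>{t \<in> triangles V. t \<inter> ?Z \<noteq> {}}. card F = k ?Z \<and> disjoint F \<and> \<Union>F \<subseteq> E)"
    proof
      assume "\<exists>F\<subseteq>{t \<in> triangles V. t \<inter> ?Z \<noteq> {}}. card F = k ?Z \<and> disjoint F \<and> \<Union>F \<subseteq> E"
      then obtain F where "F \<subseteq> {t \<in> triangles V. t \<inter> ?Z \<noteq> {}}" "card F = k ?Z" "disjoint F" "\<Union>F \<subseteq> E"
        by blast
      moreover from this(4) have "\<forall>e\<in>\<Union>F. g e = 0" by (auto simp: E_def)
      ultimately have "g \<in> Tri ?Z" using g(1) unfolding Tri_def by blast
      thus False using ng(2) by simp
    qed
    have "card ?Z \<le> 8 * Q * card (?Z \<inter> (E - \<Union>F))"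
      using card_Int_removal_ge[OF finV _ pair(2)[OF S] Q0 _ few tri F(1,2,3)] pair(1)[OF S]
      by (simp add: U_def k_def)
    moreover have "card (?Z \<inter> (E - \<Union>F)) \<le> edges_between (E - \<Union>F) X Y"
      using XY by (intro card_pairs_between_Int_le) (auto intro: finite_subset)
    hence "8 * Q * card (?Z \<inter> (E - \<Union>F)) \<le> 8 * Q * edges_between (E - \<Union>F) X Y"
      by (rule mult_left_mono) auto
    ultimately have "4 * card ?Z \<le> 32 * Q * edges_between (E - \<Union>F) X Y" by linarith
    moreover have "card X * card Y \<le> 4 * card ?Z"
      using pair(3)[OF S] by (simp flip: of_nat_mult of_nat_le_iff)
    ultimately show "card X * card Y \<le> 32 * Q * edges_between (E - \<Union>F) X Y" by linarith
  qed
qed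

section \<open>A random matching between bins\<close>

text \<open>With \<open>h\<close> an adjacency matrix and \<open>p\<close>, \<open>q\<close>
  indicators of layers, this turns an edge count with multiplicities into a sum of edge counts
  between layers.\<close>

lemma sum_bilinear_swap:
  fixes h :: "'a \<Rightarrow> 'b \<Rightarrow> 'c :: comm_semiring_0"
  shows "(\<Sum>x\<in>A. \<Sum>y\<in>B. h x y * ((\<Sum>l\<in>I. p l x) * (\<Sum>l\<in>J. q l y)))
    = (\<Sum>l\<in>I. \<Sum>l'\<in>J. \<Sum>x\<in>A. \<Sum>y\<in>B. h x y * (p l x * q l' y))"
proof -
  have "(\<Sum>x\<in>A. \<Sum>y\<in>B. h x y * ((\<Sum>l\<in>I. p l x) * (\<Sum>l\<in>J. q l y)))
      = (\<Sum>(x, y)\<in>A \<times> B. \<Sum>(l, l')\<in>I \<times> J. h x y * (p l x * q l' y))"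
    unfolding sum_product sum.cartesian_product by (simp add: sum_distrib_left case_prod_unfold)
  also have "\<dots> = (\<Sum>(l, l')\<in>I \<times> J. \<Sum>(x, y)\<in>A \<times> B. h x y * (p l x * q l' y))"
    unfolding case_prod_unfold by (rule sum.swap)
  finally show ?thesis by (simp only: sum.cartesian_product[symmetric])
qed

text \<open>The edges between two multisets of vertices are counted by cutting both multisets into
  layers \<open>{x. l < mult x}\<close>.\<close>

lemma dense_layers:
  fixes \<alpha> \<beta> :: "nat \<Rightarrow> nat" and s :: real
  assumes H: "H \<subseteq> nsets {..<m} 2"
    and dense: "\<And>X Y. X \<subseteq> {..<m} \<Longrightarrow> Y \<subseteq> {..<m} \<Longrightarrow> s \<le> real (card X) \<Longrightarrow> s \<le> real (card Y)
       \<Longrightarrow> card X * card Y \<le> C * edges_between H X Y"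
    and \<alpha>: "\<alpha> \<in> {..<r} \<rightarrow> {..m}" "m \<le> card {i\<in>{..<r}. \<alpha> i < m}"
      "\<And>x. x < m \<Longrightarrow> card {i\<in>{..<r}. \<alpha> i = x} \<le> T"
    and \<beta>: "\<beta> \<in> {..<r} \<rightarrow> {..m}" "m \<le> card {i\<in>{..<r}. \<beta> i < m}"
      "\<And>x. x < m \<Longrightarrow> card {i\<in>{..<r}. \<beta> i = x} \<le> T"
    and s: "s \<ge> 0" "2 * real T * s \<le> real m"
  shows "m ^ 2 \<le> 4 * C * (\<Sum>i<r. card {b\<in>{..<r}. {\<alpha> i, \<beta> b} \<in> H})"
proof -
  define h where "h = (\<lambda>x y. if {x, y} \<in> H then 1 else 0 :: nat)"
  define c where "c = (\<lambda>(\<gamma>::nat \<Rightarrow> nat) x. card {i\<in>{..<r}. \<gamma> i = x})"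
  define L where "L = (\<lambda>(\<gamma>::nat \<Rightarrow> nat) l. {x\<in>{..<m}. l < c \<gamma> x})"
  \<comment> \<open>The value \<open>m\<close>, which marks a missing block, is no vertex of
    \<open>H\<close> and contributes nothing.\<close>
  have hm: "h x y = 0" if "x \<ge> m \<or> y \<ge> m" for x y
  proof -
    have "{x, y} \<notin> H" using H that by (force simp: nsets_def)
    thus ?thesis by (simp add: h_def)
  qed
  \<comment> \<open>A multiplicity of at most \<open>T\<close> is the number of layers containing
    the vertex.\<close>
  have Tsum: "(\<Sum>l<T. if l < n then 1 else 0) = n" if "n \<le> T" for n :: nat
  proof -
    have "{..<T} \<inter> {l. l < n} = {..<n}" using that by auto
    thus ?thesis by (simp add: sum.If_cases)
  qed
  have group: "(\<Sum>i<r. g (\<gamma> i)) = (\<Sum>x<m. c \<gamma> x * g x)"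
    if "\<gamma> \<in> {..<r} \<rightarrow> {..m}" "g m = 0" for \<gamma> :: "nat \<Rightarrow> nat" and g :: "nat \<Rightarrow> nat"
  proof -
    have "(\<Sum>i<r. g (\<gamma> i)) = (\<Sum>x\<in>{..m}. of_nat (c \<gamma> x) * g x)"
      unfolding c_def by (rule sum_fun_comp) (use that in auto)
    also have "\<dots> = (\<Sum>x<m. c \<gamma> x * g x)" using that(2) by (simp flip: lessThan_Suc_atMost)
    finally show ?thesis .
  qed
  have eb: "edges_between H (L \<alpha> l) (L \<beta> l')
      = (\<Sum>x<m. \<Sum>y<m. h x y * ((if l < c \<alpha> x then 1 else 0) * (if l' < c \<beta> y then 1 else 0)))" for l l'
  proof -
    have "edges_between H (L \<alpha> l) (L \<beta> l') = card {p \<in> L \<alpha> l \<times> L \<beta> l'. {fst p, snd p} \<in> H}"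
      unfolding edges_between_def by (rule arg_cong[of _ _ card]) auto
    also have "\<dots> = (\<Sum>p\<in>{..<m} \<times> {..<m}. if fst p \<in> L \<alpha> l \<and> snd p \<in> L \<beta> l' \<and> {fst p, snd p} \<in> H then 1 else 0)"
      by (subst sum.inter_filter[symmetric]) (auto simp: L_def intro!: arg_cong[of _ _ card])
    also have "\<dots> = (\<Sum>x<m. \<Sum>y<m. if x \<in> L \<alpha> l \<and> y \<in> L \<beta> l' \<and> {x, y} \<in> H then 1 else 0)"
      by (simp add: sum.cartesian_product case_prod_unfold)
    also have "\<dots> = (\<Sum>x<m. \<Sum>y<m. h x y * ((if l < c \<alpha> x then 1 else 0) * (if l' < c \<beta> y then 1 else 0)))"
      by (intro sum.cong refl) (auto simp: h_def L_def)
    finally show ?thesis .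
  qed
  have "(\<Sum>i<r. card {b\<in>{..<r}. {\<alpha> i, \<beta> b} \<in> H}) = (\<Sum>i<r. \<Sum>b<r. h (\<alpha> i) (\<beta> b))"
    by (intro sum.cong refl) (simp add: h_def sum.If_cases Int_def)
  also have "\<dots> = (\<Sum>i<r. \<Sum>y<m. c \<beta> y * h (\<alpha> i) y)"
    by (intro sum.cong refl group \<beta>(1)) (simp add: hm)
  also have "\<dots> = (\<Sum>x<m. c \<alpha> x * (\<Sum>y<m. c \<beta> y * h x y))"
    by (rule group[OF \<alpha>(1)]) (simp add: hm)
  also have "\<dots> = (\<Sum>x<m. \<Sum>y<m. h x y * (c \<alpha> x * c \<beta> y))"
    by (simp add: sum_distrib_left mult_ac)
  also have "\<dots> = (\<Sum>x<m. \<Sum>y<m. h x y * ((\<Sum>l<T. if l < c \<alpha> x then 1 else 0) * (\<Sum>l<T. if l < c \<beta> y then 1 else 0)))"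
    using \<alpha>(3) \<beta>(3) by (intro sum.cong refl) (simp add: Tsum c_def)
  also have "\<dots> = (\<Sum>l<T. \<Sum>l'<T. \<Sum>x<m. \<Sum>y<m. h x y * ((if l < c \<alpha> x then 1 else 0) * (if l' < c \<beta> y then 1 else 0)))"
    by (rule sum_bilinear_swap)
  also have "\<dots> = (\<Sum>l<T. \<Sum>l'<T. edges_between H (L \<alpha> l) (L \<beta> l'))" by (simp only: eb)
  finally have D: "(\<Sum>i<r. card {b\<in>{..<r}. {\<alpha> i, \<beta> b} \<in> H}) = (\<Sum>l<T. \<Sum>l'<T. edges_between H (L \<alpha> l) (L \<beta> l'))" .
  define S where "S = (\<lambda>\<gamma>. {l\<in>{..<T}. s \<le> real (card (L \<gamma> l))})"
  \<comment> \<open>The layers with fewer than \<open>s\<close> vertices hold at most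
    \<open>T * s \<le> m / 2\<close> of the at least \<open>m\<close> points counted, so the large
    layers, to which \<open>dense\<close> applies, keep at least \<open>m / 2\<close>.\<close>
  have half: "real m / 2 \<le> real (\<Sum>l\<in>S \<gamma>. card (L \<gamma> l))"
    if \<gamma>: "\<gamma> \<in> {..<r} \<rightarrow> {..m}" "m \<le> card {i\<in>{..<r}. \<gamma> i < m}"
      "\<And>x. x < m \<Longrightarrow> card {i\<in>{..<r}. \<gamma> i = x} \<le> T" for \<gamma>
  proof -
    have "card {i\<in>{..<r}. \<gamma> i < m} = (\<Sum>i<r. if \<gamma> i < m then 1 else 0)" by (simp add: sum.If_cases Int_def)
    also have "\<dots> = (\<Sum>x<m. c \<gamma> x * (if x < m then 1 else 0))" by (rule group[OF \<gamma>(1)]) simp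
    also have "\<dots> = (\<Sum>x<m. \<Sum>l<T. if l < c \<gamma> x then 1 else 0)"
      using \<gamma>(3) by (intro sum.cong refl) (simp add: Tsum c_def)
    also have "\<dots> = (\<Sum>l<T. \<Sum>x<m. if l < c \<gamma> x then 1 else 0)" by (rule sum.swap)
    also have "\<dots> = (\<Sum>l<T. card (L \<gamma> l))" by (simp add: sum.If_cases L_def Int_def)
    also have "\<dots> = (\<Sum>l\<in>S \<gamma>. card (L \<gamma> l)) + (\<Sum>l\<in>{..<T} - S \<gamma>. card (L \<gamma> l))"
      by (subst add.commute, rule sum.subset_diff) (auto simp: S_def)
    finally have "real m \<le> real (\<Sum>l\<in>S \<gamma>. card (L \<gamma> l)) + (\<Sum>l\<in>{..<T} - S \<gamma>. real (card (L \<gamma> l)))"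
      using \<gamma>(2) by (simp flip: of_nat_sum of_nat_add)
    also have "(\<Sum>l\<in>{..<T} - S \<gamma>. real (card (L \<gamma> l))) \<le> (\<Sum>l\<in>{..<T} - S \<gamma>. s)"
      by (intro sum_mono) (auto simp: S_def)
    also have "\<dots> \<le> (\<Sum>l<T. s)" using s by (intro sum_mono2) auto
    finally show ?thesis using s(2) by simp
  qed
  have "real m / 2 * (real m / 2) \<le> real (\<Sum>l\<in>S \<alpha>. card (L \<alpha> l)) * real (\<Sum>l\<in>S \<beta>. card (L \<beta> l))"
    using half[OF \<alpha>] half[OF \<beta>] by (intro mult_mono) auto
  hence "real (m ^ 2) \<le> real (4 * ((\<Sum>l\<in>S \<alpha>. card (L \<alpha> l)) * (\<Sum>l\<in>S \<beta>. card (L \<beta> l))))"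
    by (simp add: power2_eq_square)
  hence "m ^ 2 \<le> 4 * ((\<Sum>l\<in>S \<alpha>. card (L \<alpha> l)) * (\<Sum>l\<in>S \<beta>. card (L \<beta> l)))"
    by (simp only: of_nat_le_iff)
  also have "\<dots> = 4 * (\<Sum>l\<in>S \<alpha>. \<Sum>l'\<in>S \<beta>. card (L \<alpha> l) * card (L \<beta> l'))" by (simp only: sum_product)
  also have "\<dots> \<le> 4 * (\<Sum>l\<in>S \<alpha>. \<Sum>l'\<in>S \<beta>. C * edges_between H (L \<alpha> l) (L \<beta> l'))"
    by (intro mult_left_mono sum_mono dense) (auto simp: S_def L_def)
  also have "\<dots> \<le> 4 * (\<Sum>l\<in>S \<alpha>. \<Sum>l'<T. C * edges_between H (L \<alpha> l) (L \<beta> l'))"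
    by (intro mult_left_mono sum_mono sum_mono2) (auto simp: S_def)
  also have "\<dots> \<le> 4 * (\<Sum>l<T. \<Sum>l'<T. C * edges_between H (L \<alpha> l) (L \<beta> l'))"
    by (intro mult_left_mono sum_mono2) (auto simp: S_def)
  also have "\<dots> = 4 * C * (\<Sum>l<T. \<Sum>l'<T. edges_between H (L \<alpha> l) (L \<beta> l'))"
    by (simp add: sum_distrib_left mult.assoc)
  finally show ?thesis by (simp only: D)
qed

section \<open>From a map between bins to a bijection between vertices\<close>

lemma extend_inj_on_to_bij_betw:
  assumes "finite A" "X \<subseteq> A" "inj_on g X" "g ` X \<subseteq> A"
  obtains \<pi> where "bij_betw \<pi> A A" "\<And>x. x \<in> X \<Longrightarrow> \<pi> x = g x"
proof -
  have fin: "finite X" using assms finite_subset by blast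
  have "card (A - X) = card (A - g ` X)"
    using assms fin by (simp add: card_Diff_subset card_image)
  then obtain h where h: "bij_betw h (A - X) (A - g ` X)"
    using assms(1) by (meson finite_Diff finite_same_card_bij)
  have "bij_betw (\<lambda>x. if x \<in> X then g x else h x) (X \<union> (A - X)) (g ` X \<union> (A - g ` X))"
    using assms(3) h by (intro bij_betw_disjoint_Un) (auto simp: bij_betw_def)
  moreover have "X \<union> (A - X) = A" "g ` X \<union> (A - g ` X) = A" using assms by auto
  ultimately show ?thesis using that[of "\<lambda>x. if x \<in> X then g x else h x"] by auto
qed

text \<open>Bin \<open>i\<close> is the interval of \<open>K\<close> numbers starting at
  \<open>i * K\<close>. Only its first \<open>d\<close> points are prescribed; the load bound leaves
  them distinct places in their target bins, and the rest of the bijection is arbitrary.\<close>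

lemma bij_betw_with_bins:
  fixes f :: "nat \<times> nat \<Rightarrow> nat"
  assumes f: "f \<in> {..<r} \<times> {..<d} \<rightarrow> {..<r}"
    and load: "\<And>b. b < r \<Longrightarrow> card {p \<in> {..<r} \<times> {..<d}. f p = b} \<le> K"
    and dK: "d \<le> K" and a: "r * K \<le> a"
  obtains \<pi> where "bij_betw \<pi> {..<a} {..<a}"
    "\<And>i j. i < r \<Longrightarrow> j < d \<Longrightarrow> \<pi> (i * K + j) div K = f (i, j)"
proof -
  define S where "S = {..<r} \<times> {..<d}"
  define W where "W = (\<lambda>b. {p \<in> S. f p = b})"
  have "\<exists>\<iota>. inj_on \<iota> (W b) \<and> \<iota> ` W b \<subseteq> {..<K}" if "b < r" for b
    using card_le_inj[of "W b" "{..<K}"] load[OF that] by (force simp: W_def S_def)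
  then obtain \<iota> where \<iota>: "\<And>b. b < r \<Longrightarrow> inj_on (\<iota> b) (W b)" "\<And>b. b < r \<Longrightarrow> \<iota> b ` W b \<subseteq> {..<K}"
    by metis
  \<comment> \<open>\<open>e\<close> turns a pair of bin and position into a number, and
    \<open>q\<close> is its prescribed image: place \<open>\<iota>\<close> within the bin
    \<open>f p\<close>.\<close>
  define q where "q = (\<lambda>p. f p * K + \<iota> (f p) p)"
  define e where "e = (\<lambda>(i, j). i * K + j :: nat)"
  have fS: "f p < r" if "p \<in> S" for p using f that by (auto simp: S_def)
  have \<iota>K: "\<iota> (f p) p < K" if "p \<in> S" for p
    using \<iota>(2)[OF fS[OF that]] that by (auto simp: W_def)
  have qdiv: "q p div K = f p" if "p \<in> S" for p using \<iota>K[OF that] by (simp add: q_def)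
  have edm: "e (i, j) div K = i" "e (i, j) mod K = j" if "j < d" for i j
    using that dK by (simp_all add: e_def)
  have injq: "inj_on q S"
  proof (rule inj_onI)
    fix p p' assume p: "p \<in> S" "p' \<in> S" "q p = q p'"
    hence "f p = f p'" using qdiv by metis
    moreover from this have "\<iota> (f p) p = \<iota> (f p) p'" using p(3) by (simp add: q_def)
    ultimately show "p = p'"
      using inj_onD[OF \<iota>(1)[OF fS[OF p(1)]], of p p'] p by (auto simp: W_def)
  qed
  have inje: "inj_on e S"
    by (rule inj_onI) (metis S_def edm lessThan_iff mem_Sigma_iff surj_pair)
  have less: "i * K + j < a" if "i < r" "j < K" for i j
  proof -
    have "i * K + j < Suc i * K" using that by simp
    also have "\<dots> \<le> r * K" using that by (intro mult_right_mono) auto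
    finally show ?thesis using a by linarith
  qed
  have "e ` S \<subseteq> {..<a}" using less dK by (fastforce simp: e_def S_def)
  moreover have "inj_on (q \<circ> inv_into S e) (e ` S)"
    using injq inje by (intro comp_inj_on inj_on_inv_into) (auto simp: inj_on_imp_bij_betw inv_into_image_cancel)
  moreover have "(q \<circ> inv_into S e) ` e ` S \<subseteq> {..<a}"
    using fS \<iota>K less by (auto simp: inv_into_f_f[OF inje] q_def)
  ultimately obtain \<pi> where \<pi>: "bij_betw \<pi> {..<a} {..<a}" "\<And>x. x \<in> e ` S \<Longrightarrow> \<pi> x = (q \<circ> inv_into S e) x"
    using extend_inj_on_to_bij_betw[of "{..<a}"] by (metis finite_lessThan)
  show ?thesis
  proof (rule that[OF \<pi>(1)])
    fix i j assume "i < r" "j < d"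
    hence ij: "(i, j) \<in> S" by (simp add: S_def)
    hence "\<pi> (e (i, j)) = q (i, j)" using \<pi>(2) by (simp add: inv_into_f_f[OF inje])
    thus "\<pi> (i * K + j) div K = f (i, j)" using qdiv[OF ij] by (simp add: e_def)
  qed
qed

text \<open>The values are independent, and each of the \<open>d\<close> points of bin
  \<open>i\<close> avoids \<open>N i\<close> with probability
  \<open>1 - card (N i) / r \<le> exp (- card (N i) / r)\<close>.\<close>

lemma card_avoiding_maps_le:
  fixes N :: "nat \<Rightarrow> nat set"
  assumes r: "r > 0" and N: "\<And>i. i < r \<Longrightarrow> N i \<subseteq> {..<r}"
  shows "real (card {f \<in> {..<r} \<times> {..<d} \<rightarrow>\<^sub>E {..<r}. \<forall>i<r. \<forall>j<d. f (i, j) \<notin> N i})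
    \<le> real r ^ (r * d) * exp (- real d * real (\<Sum>i<r. card (N i)) / real r)"
    (is "real (card ?A) \<le> _")
proof -
  let ?I = "{..<r} \<times> {..<d}"
  have "?A \<subseteq> (\<Pi>\<^sub>E p\<in>?I. {..<r} - N (fst p))"
  proof (intro subsetI PiE_I)
    fix f p assume f: "f \<in> ?A" "p \<in> ?I"
    hence "f p \<in> {..<r}" by (auto dest: PiE_mem)
    thus "f p \<in> {..<r} - N (fst p)" using f by auto
  qed (auto intro: PiE_arb)
  hence "card ?A \<le> card (\<Pi>\<^sub>E p\<in>?I. {..<r} - N (fst p))"
    by (intro card_mono finite_PiE) auto
  also have "\<dots> = (\<Prod>p\<in>?I. card ({..<r} - N (fst p)))" by (rule card_PiE) simp
  finally have "real (card ?A) \<le> real (\<Prod>p\<in>?I. card ({..<r} - N (fst p)))" by (rule of_nat_mono)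
  also have "\<dots> = (\<Prod>p\<in>?I. real (card ({..<r} - N (fst p))))" by simp
  also have "\<dots> \<le> (\<Prod>p\<in>?I. real r * exp (- real (card (N (fst p))) / real r))"
  proof (rule prod_mono, rule conjI)
    fix p assume "p \<in> ?I"
    hence i: "N (fst p) \<subseteq> {..<r}" using N[of "fst p"] by auto
    have "real (card ({..<r} - N (fst p))) = real r - real (card (N (fst p)))"
      using i card_mono[OF _ i] by (simp add: card_Diff_subset finite_subset[OF i] of_nat_diff)
    also have "\<dots> = real r * (1 + - real (card (N (fst p))) / real r)" using r by (simp add: field_simps)
    also have "\<dots> \<le> real r * exp (- real (card (N (fst p))) / real r)"
      by (intro mult_left_mono exp_ge_add_one_self) auto
    finally show "real (card ({..<r} - N (fst p))) \<le> real r * exp (- real (card (N (fst p))) / real r)" .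
  qed auto
  also have "\<dots> = real r ^ (r * d) * exp (\<Sum>p\<in>?I. - real (card (N (fst p))) / real r)"
    by (simp add: prod.distrib exp_sum card_cartesian_product)
  also have "(\<Sum>p\<in>?I. - real (card (N (fst p))) / real r) = (\<Sum>i<r. \<Sum>j<d. - real (card (N i)) / real r)"
    by (simp only: sum.cartesian_product case_prod_unfold)
  also have "\<dots> = - real d * real (\<Sum>i<r. card (N i)) / real r"
    by (simp add: sum_distrib_left sum_divide_distrib sum_negf)
  finally show ?thesis .
qed

text \<open>A union bound over the bin \<open>b\<close> and a set of \<open>K\<close> points that
  all fall into it, which has probability \<open>1 / r ^ K\<close>.\<close>

lemma card_overloaded_maps_le:
  fixes r K :: nat
  assumes I: "finite I" and r: "r > 0" and K: "K > 0"
  shows "real (card {f \<in> I \<rightarrow>\<^sub>E {..<r}. \<exists>b<r. K \<le> card {p\<in>I. f p = b}})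
    \<le> real r ^ card I * (real r * (exp 1 * real (card I) / (real K * real r)) ^ K)"
    (is "real (card ?A) \<le> _")
proof -
  define \<W> where "\<W> = {W. W \<subseteq> I \<and> card W = K}"
  define G where "G = (\<lambda>(b, W). {f \<in> I \<rightarrow>\<^sub>E {..<r}. \<forall>p\<in>W. f p = b})"
  have fin: "finite (I \<rightarrow>\<^sub>E {..<r})" using I by (simp add: finite_PiE)
  have finW: "finite \<W>" using I by (simp add: \<W>_def)
  have cW: "card \<W> = card I choose K" using n_subsets[OF I] by (simp add: \<W>_def)
  have "?A \<subseteq> (\<Union>bW\<in>{..<r} \<times> \<W>. G bW)"
  proof
    fix f assume "f \<in> ?A"
    then obtain b where b: "f \<in> I \<rightarrow>\<^sub>E {..<r}" "b < r" "K \<le> card {p\<in>I. f p = b}" by blast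
    obtain W where W: "W \<subseteq> {p\<in>I. f p = b}" "card W = K" using b(3) by (meson obtain_subset_with_card_n)
    have "f \<in> G (b, W)" using b W by (auto simp: G_def)
    moreover have "(b, W) \<in> {..<r} \<times> \<W>" using b W by (auto simp: \<W>_def)
    ultimately show "f \<in> (\<Union>bW\<in>{..<r} \<times> \<W>. G bW)" by (rule UN_I[rotated])
  qed
  moreover have "finite (\<Union>bW\<in>{..<r} \<times> \<W>. G bW)"
    by (rule finite_subset[OF _ fin]) (auto simp: G_def)
  ultimately have "card ?A \<le> card (\<Union>bW\<in>{..<r} \<times> \<W>. G bW)" by (intro card_mono)
  also have "\<dots> \<le> (\<Sum>bW\<in>{..<r} \<times> \<W>. card (G bW))" using finW by (intro card_UN_le) auto
  finally have "real (card ?A) \<le> real (\<Sum>bW\<in>{..<r} \<times> \<W>. card (G bW))" by (rule of_nat_mono)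
  also have "\<dots> = (\<Sum>bW\<in>{..<r} \<times> \<W>. real (card (G bW)))" by (rule of_nat_sum)
  also have "\<dots> = (\<Sum>bW\<in>{..<r} \<times> \<W>. real r ^ card I / real r ^ K)"
  proof (rule sum.cong[OF refl])
    fix bW assume "bW \<in> {..<r} \<times> \<W>"
    then obtain b W where bW: "bW = (b, W)" "b < r" "W \<subseteq> I" "card W = K" by (auto simp: \<W>_def)
    have "card (G bW) * r ^ K = r ^ card I"
      using card_PiE_const_on[OF I _ bW(3), of "{..<r}" b] bW by (simp add: G_def)
    hence "real (card (G bW) * r ^ K) = real (r ^ card I)" by (rule arg_cong)
    thus "real (card (G bW)) = real r ^ card I / real r ^ K" using r by (simp add: field_simps)
  qed
  also have "\<dots> = real r * real (card I choose K) * (real r ^ card I / real r ^ K)"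
    by (simp add: card_cartesian_product cW)
  also have "\<dots> \<le> real r * (exp 1 * real (card I) / real K) ^ K * (real r ^ card I / real r ^ K)"
    by (intro mult_right_mono mult_left_mono choose_le_exp_power K) auto
  also have "\<dots> = real r ^ card I * (real r * (exp 1 * real (card I) / (real K * real r)) ^ K)"
    by (simp add: power_divide power_mult_distrib)
  finally show ?thesis .
qed

text \<open>A random \<open>f\<close> fails for a fixed pair of assignments with probability at most
  \<open>exp (- m * (4 * ln (m + 1) + 1))\<close>. There are at most
  \<open>(m + 1) ^ (4 * m)\<close> pairs, which leaves \<open>exp (- m) < 1/2\<close>; overloaded
  bins add at most 1/2.\<close>

lemma exists_spreading_map:
  fixes m C d :: nat
  assumes m: "m > 0" and C: "C > 0"
    and Adm: "Adm \<subseteq> {..<2 * m} \<rightarrow>\<^sub>E {..m}"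
    and dense: "\<And>\<alpha> \<beta>. \<alpha> \<in> Adm \<Longrightarrow> \<beta> \<in> Adm
      \<Longrightarrow> m ^ 2 \<le> 4 * C * (\<Sum>i<2 * m. card {b\<in>{..<2 * m}. {\<alpha> i, \<beta> b} \<in> H})"
    and d: "real d \<ge> 8 * real C * (4 * ln (real m + 1) + 1)"
  obtains f where "f \<in> {..<2 * m} \<times> {..<d} \<rightarrow> {..<2 * m}"
    "\<And>b. b < 2 * m \<Longrightarrow> card {p \<in> {..<2 * m} \<times> {..<d}. f p = b} \<le> 9 * d"
    "\<And>\<alpha> \<beta>. \<alpha> \<in> Adm \<Longrightarrow> \<beta> \<in> Adm \<Longrightarrow> \<exists>i<2 * m. \<exists>j<d. {\<alpha> i, \<beta> (f (i, j))} \<in> H"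
proof -
  define r where "r = 2 * m"
  define I where "I = {..<r} \<times> {..<d}"
  define \<Omega> where "\<Omega> = I \<rightarrow>\<^sub>E {..<r}"
  define N where "N = (\<lambda>(\<alpha>::nat\<Rightarrow>nat) (\<beta>::nat\<Rightarrow>nat) i. {b\<in>{..<r}. {\<alpha> i, \<beta> b} \<in> H})"
  define Av where "Av = (\<lambda>(\<alpha>, \<beta>). {f \<in> \<Omega>. \<forall>i<r. \<forall>j<d. f (i, j) \<notin> N \<alpha> \<beta> i})"
  define Ov where "Ov = {f \<in> \<Omega>. \<exists>b<r. 9 * d \<le> card {p\<in>I. f p = b}}"
  let ?q = "real r ^ (r * d)" and ?L = "ln (real m + 1)"
  have r0: "r > 0" using m by (simp add: r_def)
  have L0: "?L \<ge> 0" by simp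
  have dL: "real d \<ge> 4 * ?L + 1"
  proof -
    have "1 * (4 * ?L + 1) \<le> (8 * real C) * (4 * ?L + 1)" using C L0 by (intro mult_right_mono) auto
    hence "4 * ?L + 1 \<le> 8 * real C * (4 * ?L + 1)" by simp
    thus ?thesis using d by (rule order.trans)
  qed
  hence d0: "d > 0" using L0 by linarith
  have finI: "finite I" "card I = r * d" by (simp_all add: I_def card_cartesian_product)
  have fin\<Omega>: "finite \<Omega>" and c\<Omega>: "real (card \<Omega>) = ?q"
    using finI by (simp_all add: \<Omega>_def finite_PiE card_PiE)
  have finPi: "finite ({..<r} \<rightarrow>\<^sub>E {..m})" by (simp add: finite_PiE)
  have finAdm: "finite Adm" using Adm finPi finite_subset unfolding r_def by blast
  have "card Adm \<le> card ({..<r} \<rightarrow>\<^sub>E {..m})" using Adm finPi by (intro card_mono) (simp_all add: r_def)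
  also have "\<dots> = (m + 1) ^ r" by (simp add: card_PiE)
  finally have "real (card Adm) \<le> real ((m + 1) ^ r)" by (rule of_nat_mono)
  hence cAdm: "real (card Adm) \<le> (real m + 1) ^ r" by (simp add: add.commute)
  have one: "real (card (Av ab)) \<le> ?q * exp (- real m * (4 * ?L + 1))" if ab: "ab \<in> Adm \<times> Adm" for ab
  proof -
    obtain \<alpha> \<beta> where ab': "ab = (\<alpha>, \<beta>)" "\<alpha> \<in> Adm" "\<beta> \<in> Adm" using ab by auto
    let ?D = "\<Sum>i<r. card (N \<alpha> \<beta> i)"
    have "m ^ 2 \<le> 4 * C * ?D" using dense[OF ab'(2,3)] by (simp add: N_def r_def)
    hence D: "real m ^ 2 \<le> 4 * real C * real ?D"
      using of_nat_mono[of "m ^ 2" "4 * C * ?D", where 'a = real] by simp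
    \<comment> \<open>From \<open>?D \<ge> m ^ 2 / (4 * C)\<close>,
      \<open>d \<ge> 8 * C * (4 * ?L + 1)\<close> and \<open>r = 2 * m\<close>, the exponent
      \<open>d * ?D / r\<close> is at least \<open>m * (4 * ?L + 1)\<close>.\<close>
    have "8 * real C * (4 * ?L + 1) * real m ^ 2 \<le> real d * (4 * real C * real ?D)"
      using d D L0 C by (intro mult_mono) auto
    moreover have "x * y \<le> u * v / (2 * x)" if "8 * c * y * x ^ 2 \<le> u * (4 * c * v)" "c > 0" "x > 0"
      for c x y u v :: real
    proof -
      have "(8 * c * x) * (x * y) \<le> (8 * c * x) * (u * v / (2 * x))"
        using that(1,3) by (simp add: power2_eq_square mult_ac)
      moreover have "8 * c * x > 0" using that by simp
      ultimately show ?thesis by (simp only: mult_le_cancel_left_pos)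
    qed
    ultimately have "real m * (4 * ?L + 1) \<le> real d * real ?D / real r"
      using m C by (simp only: r_def of_nat_mult of_nat_numeral of_nat_0_less_iff)
    hence e: "exp (- real d * real ?D / real r) \<le> exp (- real m * (4 * ?L + 1))" by simp
    have "real (card (Av ab)) \<le> ?q * exp (- real d * real ?D / real r)"
      unfolding Av_def ab'(1) \<Omega>_def I_def prod.case
      by (rule card_avoiding_maps_le[OF r0]) (auto simp: N_def)
    also have "\<dots> \<le> ?q * exp (- real m * (4 * ?L + 1))" using e by (intro mult_left_mono) auto
    finally show ?thesis .
  qed
  have "card (\<Union>ab\<in>Adm \<times> Adm. Av ab) \<le> (\<Sum>ab\<in>Adm \<times> Adm. card (Av ab))"
    using finAdm by (intro card_UN_le) auto
  hence "real (card (\<Union>ab\<in>Adm \<times> Adm. Av ab)) \<le> real (\<Sum>ab\<in>Adm \<times> Adm. card (Av ab))" by (rule of_nat_mono)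
  also have "\<dots> \<le> (\<Sum>ab\<in>Adm \<times> Adm. ?q * exp (- real m * (4 * ?L + 1)))"
    unfolding of_nat_sum by (intro sum_mono one)
  also have "\<dots> = real (card Adm) * real (card Adm) * (?q * exp (- real m * (4 * ?L + 1)))"
    by (simp add: card_cartesian_product)
  also have "\<dots> \<le> (real m + 1) ^ r * (real m + 1) ^ r * (?q * exp (- real m * (4 * ?L + 1)))"
    using cAdm by (intro mult_right_mono mult_mono) auto
  also have "\<dots> = ?q * exp (- real m)"
  proof -
    have "(real m + 1) ^ r = exp (2 * real m * ?L)"
    proof -
      have "(real m + 1) ^ r = exp ?L ^ r" by simp
      also have "\<dots> = exp (real r * ?L)" by (rule exp_of_nat_mult[symmetric])
      finally show ?thesis by (simp add: r_def)
    qed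
    thus ?thesis by (simp add: algebra_simps flip: exp_add)
  qed
  also have "\<dots> < ?q * (1/2)"
  proof (rule mult_strict_left_mono)
    have "1 + 1 + 1\<^sup>2 / 2 \<le> exp (1::real)" by (rule exp_lower_Taylor_quadratic) simp
    hence "2 < exp (1::real)" by simp
    also have "exp 1 \<le> exp (real m)" using m by simp
    finally have "2 < exp (real m)" .
    thus "exp (- real m) < 1/2" by (simp add: exp_minus field_simps)
  qed (use r0 in auto)
  finally have AvU: "real (card (\<Union>ab\<in>Adm \<times> Adm. Av ab)) < ?q * (1/2)" .
  have "real (card Ov) \<le> ?q * (real r * (exp 1 * real (card I) / (real (9 * d) * real r)) ^ (9 * d))"
    using card_overloaded_maps_le[OF finI(1) r0, of "9 * d"] d0
    unfolding Ov_def \<Omega>_def finI(2) by simp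
  \<comment> \<open>The mean load of a bin is \<open>d\<close>. Allowing 9 times as much gives the
    base \<open>e / 9\<close>, at most \<open>1 / e\<close> because
    \<open>e ^ 2 \<le> 9\<close>.\<close>
  also have "\<dots> \<le> ?q * (real r * exp (- 1) ^ (9 * d))"
  proof (intro mult_left_mono power_mono)
    have "exp (1::real) * exp 1 \<le> 3 * 3" using exp_le by (intro mult_mono) auto
    hence "exp 1 / 9 \<le> exp (- 1 :: real)" by (simp add: exp_minus field_simps)
    moreover have "exp 1 * real (card I) / (real (9 * d) * real r) = exp 1 / 9"
      using r0 d0 by (simp add: finI(2))
    ultimately show "exp 1 * real (card I) / (real (9 * d) * real r) \<le> exp (- 1)"
      by (simp only:)
  qed auto
  also have "exp (- 1) ^ (9 * d) = exp (- 9 * real d)" by (simp flip: exp_of_nat_mult)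
  also have "?q * (real r * exp (- 9 * real d)) \<le> ?q * (1/2)"
  proof (rule mult_left_mono)
    have "exp (- 9 * real d) \<le> exp (- (2 * ?L))" using dL L0 by simp
    also have "\<dots> = 1 / (real m + 1) ^ 2" by (simp add: exp_minus exp_double inverse_eq_divide)
    finally have "real r * exp (- 9 * real d) \<le> real r * (1 / (real m + 1) ^ 2)"
      by (intro mult_left_mono) auto
    also have "\<dots> \<le> 1/2"
    proof -
      have "4 * real m \<le> (real m + 1) ^ 2"
        using zero_le_power2[of "real m - 1"] by (simp add: algebra_simps power2_eq_square)
      moreover have "(real m + 1) ^ 2 > 0" by (simp add: add_nonneg_pos)
      ultimately show ?thesis by (simp add: r_def pos_divide_le_eq)
    qed
    finally show "real r * exp (- 9 * real d) \<le> 1/2" .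
  qed simp
  finally have "real (card Ov) \<le> ?q * (1/2)" .
  with AvU have "real (card (\<Union>ab\<in>Adm \<times> Adm. Av ab)) + real (card Ov) < real (card \<Omega>)"
    using c\<Omega> by linarith
  hence lt: "card (\<Union>ab\<in>Adm \<times> Adm. Av ab) + card Ov < card \<Omega>" by linarith
  have "\<not> \<Omega> \<subseteq> (\<Union>ab\<in>Adm \<times> Adm. Av ab) \<union> Ov"
  proof
    assume sub: "\<Omega> \<subseteq> (\<Union>ab\<in>Adm \<times> Adm. Av ab) \<union> Ov"
    have "(\<Union>ab\<in>Adm \<times> Adm. Av ab) \<union> Ov \<subseteq> \<Omega>" by (auto simp: Av_def Ov_def)
    hence "finite ((\<Union>ab\<in>Adm \<times> Adm. Av ab) \<union> Ov)" using fin\<Omega> finite_subset by blast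
    hence "card \<Omega> \<le> card ((\<Union>ab\<in>Adm \<times> Adm. Av ab) \<union> Ov)" using sub by (rule card_mono)
    also have "\<dots> \<le> card (\<Union>ab\<in>Adm \<times> Adm. Av ab) + card Ov" by (rule card_Un_le)
    finally show False using lt by linarith
  qed
  then obtain f where f: "f \<in> \<Omega>" "\<And>ab. ab \<in> Adm \<times> Adm \<Longrightarrow> f \<notin> Av ab" "f \<notin> Ov" by blast
  show ?thesis
  proof (rule that[of f])
    show "f \<in> {..<2 * m} \<times> {..<d} \<rightarrow> {..<2 * m}" using f(1) by (auto simp: \<Omega>_def I_def r_def PiE_def)
    show "card {p \<in> {..<2 * m} \<times> {..<d}. f p = b} \<le> 9 * d" if "b < 2 * m" for b
      using f(1,3) that by (force simp: Ov_def I_def r_def)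
    fix \<alpha> \<beta> assume ab: "\<alpha> \<in> Adm" "\<beta> \<in> Adm"
    hence "f \<notin> Av (\<alpha>, \<beta>)" using f(2) by blast
    thus "\<exists>i<2 * m. \<exists>j<d. {\<alpha> i, \<beta> (f (i, j))} \<in> H" using f(1) by (auto simp: Av_def N_def r_def)
  qed
qed

text \<open>The value \<open>m\<close> stands for a bin that does not lie in a single block.\<close>

definition admissible :: "nat \<Rightarrow> nat \<Rightarrow> (nat \<Rightarrow> nat) \<Rightarrow> bool" where
  "admissible m T \<gamma> \<longleftrightarrow> \<gamma> \<in> {..<2 * m} \<rightarrow> {..m} \<and> m \<le> card {i\<in>{..<2 * m}. \<gamma> i < m} \<and>
     (\<forall>x<m. card {i\<in>{..<2 * m}. \<gamma> i = x} \<le> T)"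

lemma admissible_cong:
  assumes "admissible m T \<gamma>" "\<And>i. i < 2 * m \<Longrightarrow> \<gamma>' i = \<gamma> i"
  shows "admissible m T \<gamma>'"
proof -
  have "{i\<in>{..<2 * m}. P (\<gamma>' i)} = {i\<in>{..<2 * m}. P (\<gamma> i)}" for P using assms(2) by auto
  note eq = this
  show ?thesis
    using assms eq[of "\<lambda>y. y < m"] eq[of "\<lambda>y. y = x" for x] by (simp add: admissible_def Pi_iff)
qed

text \<open>The graph supplies the density constant \<open>C = 32 * Q\<close>, whence
  \<open>8 * C = 256 * Q\<close> in the bound on \<open>d\<close>. Bins have \<open>9 * d\<close>
  places because that is the maximal load of the spreading map.\<close>

lemma exists_spreading_bijection:
  fixes m Q T d a :: nat and s :: real
  assumes m: "m \<ge> 4" and Q: "2 ^ 20 * m \<le> Q ^ 2" and s: "s \<ge> 64 * real Q * ln (real m)"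
    and T: "2 * real T * s \<le> real m" and d: "real d \<ge> 256 * real Q * (4 * ln (real m + 1) + 1)"
    and a: "2 * m * (9 * d) \<le> a"
  obtains H \<pi> where "H \<subseteq> nsets {..<m} 2" "\<And>t. t \<in> triangles {..<m} \<Longrightarrow> \<not> t \<subseteq> H"
    "bij_betw \<pi> {..<a} {..<a}"
    "\<And>\<alpha> \<beta>. admissible m T \<alpha> \<Longrightarrow> admissible m T \<beta> \<Longrightarrow>
       \<exists>x<a. x div (9 * d) < 2 * m \<and> \<pi> x div (9 * d) < 2 * m \<and> {\<alpha> (x div (9 * d)), \<beta> (\<pi> x div (9 * d))} \<in> H"
proof -
  obtain H where H: "H \<subseteq> nsets {..<m} 2" "\<And>t. t \<in> triangles {..<m} \<Longrightarrow> \<not> t \<subseteq> H"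
    "\<And>X Y. X \<subseteq> {..<m} \<Longrightarrow> Y \<subseteq> {..<m} \<Longrightarrow> s \<le> real (card X) \<Longrightarrow> s \<le> real (card Y)
       \<Longrightarrow> card X * card Y \<le> (32 * Q) * edges_between H X Y"
    using exists_triangle_free_dense[OF m Q s] by metis
  have Q0: "32 * Q > 0" using Q m by (cases "Q = 0") auto
  have "64 * real Q * ln (real m) \<ge> 0" using m by simp
  hence s0: "s \<ge> 0" using s by linarith
  \<comment> \<open>Extensional functions make the family finite; since \<open>admissible\<close>
    only looks at the \<open>2 * m\<close> bins, restriction preserves it.\<close>
  define Adm where "Adm = {\<gamma> \<in> {..<2 * m} \<rightarrow>\<^sub>E {..m}. admissible m T \<gamma>}"
  have dense: "m ^ 2 \<le> 4 * (32 * Q) * (\<Sum>i<2 * m. card {b\<in>{..<2 * m}. {\<alpha> i, \<beta> b} \<in> H})"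
    if "\<alpha> \<in> Adm" "\<beta> \<in> Adm" for \<alpha> \<beta>
    by (rule dense_layers[OF H(1,3)]) (use that s0 T in \<open>auto simp: Adm_def admissible_def\<close>)
  have d': "real d \<ge> 8 * real (32 * Q) * (4 * ln (real m + 1) + 1)" using d by simp
  have m0: "m > 0" using m by simp
  obtain f where f: "f \<in> {..<2 * m} \<times> {..<d} \<rightarrow> {..<2 * m}"
    "\<And>b. b < 2 * m \<Longrightarrow> card {p \<in> {..<2 * m} \<times> {..<d}. f p = b} \<le> 9 * d"
    "\<And>\<alpha> \<beta>. \<alpha> \<in> Adm \<Longrightarrow> \<beta> \<in> Adm \<Longrightarrow> \<exists>i<2 * m. \<exists>j<d. {\<alpha> i, \<beta> (f (i, j))} \<in> H"
    by (rule exists_spreading_map[OF m0 Q0 _ dense d', of Adm]) (auto simp: Adm_def)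
  obtain \<pi> where \<pi>: "bij_betw \<pi> {..<a} {..<a}"
    "\<And>i j. i < 2 * m \<Longrightarrow> j < d \<Longrightarrow> \<pi> (i * (9 * d) + j) div (9 * d) = f (i, j)"
    using bij_betw_with_bins[OF f(1,2) _ a] by auto
  show ?thesis
  proof (rule that[OF H(1,2) \<pi>(1)])
    fix \<alpha> \<beta> assume ab: "admissible m T \<alpha>" "admissible m T \<beta>"
    define \<alpha>' \<beta>' where "\<alpha>' = restrict \<alpha> {..<2 * m}" and "\<beta>' = restrict \<beta> {..<2 * m}"
    have "\<alpha>' \<in> Adm" "\<beta>' \<in> Adm"
      using ab admissible_cong[of m T \<alpha> \<alpha>'] admissible_cong[of m T \<beta> \<beta>']
      by (auto simp: Adm_def \<alpha>'_def \<beta>'_def admissible_def)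
    then obtain i j where ij: "i < 2 * m" "j < d" "{\<alpha>' i, \<beta>' (f (i, j))} \<in> H" using f(3) by blast
    define x where "x = i * (9 * d) + j"
    have xd: "x div (9 * d) = i" using ij(2) by (simp add: x_def)
    have fij: "f (i, j) < 2 * m" using f(1) ij by auto
    have "i * (9 * d) + j < Suc i * (9 * d)" using ij(2) by simp
    also have "\<dots> \<le> 2 * m * (9 * d)" using ij(1) by (intro mult_right_mono) auto
    finally have "x < a" using a by (simp add: x_def)
    moreover have "\<pi> x div (9 * d) = f (i, j)" using \<pi>(2)[OF ij(1,2)] by (simp add: x_def)
    moreover have "{\<alpha> i, \<beta> (f (i, j))} \<in> H" using ij fij by (simp add: \<alpha>'_def \<beta>'_def)
    ultimately show "\<exists>x<a. x div (9 * d) < 2 * m \<and> \<pi> x div (9 * d) < 2 * m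
        \<and> {\<alpha> (x div (9 * d)), \<beta> (\<pi> x div (9 * d))} \<in> H"
      using ij(1) xd fij by metis
  qed
qed

section \<open>Ordered graphs\<close>

text \<open>The vertices \<open>v\<close> and \<open>\<tau> v\<close> name the same edge, so
  \<open>v\<close> lies on no other.\<close>

lemma ordered_matching_of_involution:
  fixes V :: "'a::linorder set"
  assumes V: "finite V" and \<tau>: "\<And>v. v \<in> V \<Longrightarrow> \<tau> v \<in> V" "\<And>v. v \<in> V \<Longrightarrow> \<tau> v \<noteq> v"
    "\<And>v. v \<in> V \<Longrightarrow> \<tau> (\<tau> v) = v"
  shows "ordered_matching \<lparr>verts = V, edges = (\<lambda>v. {v, \<tau> v}) ` V\<rparr>"
proof -
  have "(\<lambda>v. {v, \<tau> v}) ` V \<subseteq> nsets V 2" using \<tau> by fastforce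
  moreover have "{e \<in> (\<lambda>v. {v, \<tau> v}) ` V. v \<in> e} = {{v, \<tau> v}}" if "v \<in> V" for v
    using that \<tau>(3) by auto
  ultimately show ?thesis using V by (simp add: ordered_matching_def ordered_graph_def degree_def)
qed

text \<open>The classes of the monotone colouring \<open>col\<close> give the upper bound. For the
  lower bound, \<open>w (Suc j)\<close> has a neighbour between \<open>w j\<close> and itself, so an
  interval with two of the points \<open>w j\<close> would contain an edge, and the \<open>k\<close>
  points need \<open>k\<close> intervals.\<close>

lemma interval_chromatic_number_eqI:
  fixes G :: "'a::linorder ograph" and col :: "'a \<Rightarrow> nat" and w :: "nat \<Rightarrow> 'a"
  assumes G: "ordered_graph G"
    and col: "\<And>u v. u \<in> verts G \<Longrightarrow> v \<in> verts G \<Longrightarrow> u \<le> v \<Longrightarrow> col u \<le> col v" "col ` verts G = {..<k}"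
    and proper: "\<And>u v. {u, v} \<in> edges G \<Longrightarrow> col u \<noteq> col v"
    and w: "\<And>j. j < k \<Longrightarrow> w j \<in> verts G" "\<And>i j. i \<le> j \<Longrightarrow> j < k \<Longrightarrow> w i \<le> w j"
      "\<And>j. Suc j < k \<Longrightarrow> \<exists>u. w j \<le> u \<and> u \<le> w (Suc j) \<and> {u, w (Suc j)} \<in> edges G"
  shows "interval_chromatic_number G = k"
  unfolding interval_chromatic_number_def
proof (rule Least_equality)
  define J where "J = (\<lambda>i. {v \<in> verts G. col v = i})"
  have ne: "J i \<noteq> {}" if "i < k" for i
  proof -
    have "i \<in> col ` verts G" using col(2) that by simp
    thus ?thesis by (auto simp: J_def)
  qed
  have "inj_on J {..<k}"
  proof (rule inj_onI)
    fix i j assume "i \<in> {..<k}" "J i = J j"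
    thus "i = j" using ne[of i] by (auto simp: J_def)
  qed
  hence card: "card (J ` {..<k}) = k" by (simp add: card_image)
  have "partition_on (verts G) (J ` {..<k})"
  proof (rule partition_onI)
    show "\<Union> (J ` {..<k}) = verts G" using col(2) by (auto simp: J_def)
    show "disjnt p q" if "p \<in> J ` {..<k}" "q \<in> J ` {..<k}" "p \<noteq> q" for p q
      using that by (auto simp: J_def disjnt_def)
    show "{} \<notin> J ` {..<k}" using ne by force
  qed
  moreover have "interval_in (verts G) (J i)" for i
    unfolding interval_in_def
  proof (intro conjI ballI impI)
    fix x z y assume "x \<in> J i" "z \<in> J i" "y \<in> verts G" "x \<le> y \<and> y \<le> z"
    thus "y \<in> J i" using col(1)[of x y] col(1)[of y z] by (simp add: J_def)
  qed (auto simp: J_def)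
  moreover have "\<not> e \<subseteq> J i" if "e \<in> edges G" for e i
  proof -
    have "e \<in> nsets (verts G) 2" using that G by (auto simp: ordered_graph_def)
    then obtain u v where "e = {u, v}" by (auto elim: nsets2_E)
    thus ?thesis using proper[of u v] that by (auto simp: J_def)
  qed
  ultimately show "\<exists>P. interval_colouring G P \<and> card P = k"
    using card by (auto simp: interval_colouring_def)
next
  fix n assume "\<exists>P. interval_colouring G P \<and> card P = n"
  then obtain P where P: "interval_colouring G P" "card P = n" by blast
  have part: "partition_on (verts G) P" using P(1) by (simp add: interval_colouring_def)
  have finP: "finite P"
    using part G by (meson finite_elements ordered_graph_def)
  have "\<exists>I. I \<in> P \<and> w j \<in> I" if "j < k" for j
    using part w(1)[OF that] by (auto simp: partition_on_def)
  then obtain I where I: "\<And>j. j < k \<Longrightarrow> I j \<in> P" "\<And>j. j < k \<Longrightarrow> w j \<in> I j" by metis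
  \<comment> \<open>An interval containing \<open>w i\<close> and \<open>w j\<close> is convex, so
    it contains the neighbour \<open>u\<close> of \<open>w j\<close>, which lies after
    \<open>w (j - 1)\<close> or equals it.\<close>
  have neq: "I i \<noteq> I j" if ij: "i < j" "j < k" for i j
  proof
    assume eq: "I i = I j"
    obtain j' where j': "j = Suc j'" using ij by (cases j) auto
    obtain u where u: "w j' \<le> u" "u \<le> w j" "{u, w j} \<in> edges G" using w(3)[of j'] ij j' by auto
    have "w i \<le> u" using w(2)[of i j'] ij j' u(1) by auto
    moreover have "u \<in> verts G" using u(3) G by (auto simp: ordered_graph_def nsets_def)
    moreover have "interval_in (verts G) (I j)" using P(1) I(1)[OF ij(2)] by (simp add: interval_colouring_def)
    moreover have "w i \<in> I j" "w j \<in> I j" using I(2) ij eq by (metis less_trans, metis)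
    ultimately have "u \<in> I j" using u(2) unfolding interval_in_def by blast
    hence "{u, w j} \<subseteq> I j" using I(2)[OF ij(2)] by simp
    thus False using P(1) u(3) I(1)[OF ij(2)] by (auto simp: interval_colouring_def)
  qed
  have "inj_on I {..<k}"
  proof (rule inj_onI)
    fix i j assume "i \<in> {..<k}" "j \<in> {..<k}" "I i = I j"
    thus "i = j" using neq[of i j] neq[of j i] by (cases i j rule: linorder_cases) auto
  qed
  moreover have "I ` {..<k} \<subseteq> P" using I(1) by auto
  ultimately have "card {..<k} \<le> card P" using finP by (intro card_inj_on_le)
  thus "k \<le> n" using P(2) by simp
qed

section \<open>Monochromatic copies as increasing embeddings\<close>

lemma has_mono_copyI:
  fixes G :: "'a::linorder ograph"
  assumes G: "ordered_graph G" and f: "strict_mono_on (verts G) f" "f ` verts G \<subseteq> {1..N}"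
    and c: "\<And>e. e \<in> edges G \<Longrightarrow> \<chi> (f ` e) = c"
  shows "has_mono_copy N \<chi> c G"
proof -
  define F where "F = \<lparr>verts = f ` verts G, edges = (\<lambda>e. f ` e) ` edges G\<rparr>"
  have inj: "inj_on f (verts G)" using f(1) by (rule strict_mono_on_imp_inj_on)
  have "f ` e \<in> nsets (f ` verts G) 2" if "e \<in> edges G" for e
  proof -
    have "e \<in> nsets (verts G) 2" using that G by (auto simp: ordered_graph_def)
    thus ?thesis using inj by (auto simp: nsets_def card_image inj_on_subset)
  qed
  hence "ordered_graph F" using G by (auto simp: F_def ordered_graph_def)
  moreover have "edges F \<subseteq> nsets {1..N} 2"
    using \<open>ordered_graph F\<close> nsets_mono[OF f(2), of 2] by (auto simp: ordered_graph_def F_def)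
  ultimately have "ordered_subgraph F (complete_ograph N)"
    using f(2) by (auto simp: ordered_subgraph_def complete_ograph_def F_def ordered_graph_def)
  moreover have "ordered_isomorphic G F"
    unfolding ordered_isomorphic_def using f(1) inj by (intro exI[of _ f]) (simp add: F_def inj_on_imp_bij_betw)
  moreover have "\<forall>e\<in>edges F. \<chi> e = c" using c by (auto simp: F_def)
  ultimately show ?thesis unfolding has_mono_copy_def by blast
qed

lemma has_mono_copyE:
  assumes "has_mono_copy N \<chi> c G"
  obtains f where "strict_mono_on (verts G) f" "f ` verts G \<subseteq> {1..N}" "\<And>e. e \<in> edges G \<Longrightarrow> \<chi> (f ` e) = c"
proof -
  obtain F f where F: "ordered_subgraph F (complete_ograph N)" "\<forall>e\<in>edges F. \<chi> e = c"
    "bij_betw f (verts G) (verts F)" "strict_mono_on (verts G) f" "edges F = (\<lambda>e. f ` e) ` edges G"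
    using assms by (auto simp: has_mono_copy_def ordered_isomorphic_def)
  show ?thesis
    using that[of f] F by (auto simp: ordered_subgraph_def complete_ograph_def bij_betw_def)
qed

lemma has_mono_copy_mono:
  assumes "has_mono_copy N \<chi> c G" "N \<le> N'" "ordered_graph G"
  shows "has_mono_copy N' \<chi> c G"
proof -
  obtain f where "strict_mono_on (verts G) f" "f ` verts G \<subseteq> {1..N}" "\<And>e. e \<in> edges G \<Longrightarrow> \<chi> (f ` e) = c"
    using has_mono_copyE[OF assms(1)] by metis
  moreover from this(2) have "f ` verts G \<subseteq> {1..N'}" using assms(2) by force
  ultimately show ?thesis using assms(3) by (intro has_mono_copyI)
qed

lemma exists_strict_mono_onto:
  fixes A :: "'a::wellorder set" and B :: "'b::wellorder set"
  assumes "finite A" "finite B" "card A = card B"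
  obtains f where "strict_mono_on A f" "f ` A = B"
proof -
  obtain g where g: "bij_betw g {..<card A} A" "strict_mono_on {..<card A} g"
    using ex_bij_betw_strict_mono_card[OF assms(1)] by metis
  obtain h where h: "bij_betw h {..<card A} B" "strict_mono_on {..<card A} h"
    using ex_bij_betw_strict_mono_card[OF assms(2)] assms(3) by metis
  let ?f = "h \<circ> inv_into {..<card A} g"
  have "strict_mono_on A ?f"
  proof (rule strict_mono_onI)
    fix x y assume xy: "x \<in> A" "y \<in> A" "x < y"
    let ?i = "inv_into {..<card A} g"
    have im: "?i x \<in> {..<card A}" "?i y \<in> {..<card A}" "g (?i x) = x" "g (?i y) = y"
      using g(1) xy inv_into_into[of _ g "{..<card A}"] f_inv_into_f[of _ g "{..<card A}"]
      by (simp_all only: bij_betw_def)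
    hence "?i x < ?i y"
      using g(2) xy(3) by (metis linorder_neqE order.asym strict_mono_onD)
    thus "?f x < ?f y" using im strict_mono_onD[OF h(2)] by (simp only: o_apply)
  qed
  moreover have "?f ` A = B"
    using h(1) g(1) by (metis bij_betw_def bij_betw_inv_into image_comp)
  ultimately show ?thesis by (rule that)
qed

section \<open>Existence of ordered Ramsey numbers and lower bounds for them\<close>

lemma ordered_graph_complete: "ordered_graph (complete_ograph N)"
  by (simp add: ordered_graph_def complete_ograph_def)

text \<open>\<open>LEAST\<close> is informative only if a witness exists. Ramsey's theorem for
  unordered graphs suffices: the increasing bijection onto a homogeneous set of the right size is an
  ordered embedding.\<close>

lemma exists_ramsey_number:
  fixes G :: "nat ograph"
  assumes G: "ordered_graph G"
  shows "\<exists>N>0. \<forall>\<chi>. has_mono_copy N \<chi> Red G \<or> has_mono_copy N \<chi> Blue (complete_ograph q)"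
proof -
  obtain N where N: "N \<ge> 1" "\<And>(V::nat set) E. finite V \<Longrightarrow> card V \<ge> N \<Longrightarrow>
      \<exists>R\<subseteq>V. card R = card (verts G) \<and> clique R E \<or> card R = q \<and> indep R E"
    using ramsey2[of "card (verts G)" q] by metis
  have "has_mono_copy N \<chi> Red G \<or> has_mono_copy N \<chi> Blue (complete_ograph q)" for \<chi>
  proof -
    obtain R where R: "R \<subseteq> {1..N}"
      "card R = card (verts G) \<and> clique R {e. \<chi> e = Red} \<or> card R = q \<and> indep R {e. \<chi> e = Red}"
      using N(2)[of "{1..N}" "{e. \<chi> e = Red}"] by auto
    have finR: "finite R" using R(1) finite_subset by blast
    have emb: "has_mono_copy N \<chi> c F"
      if F: "ordered_graph F" "card R = card (verts F)" and c: "\<And>u v. u \<in> R \<Longrightarrow> v \<in> R \<Longrightarrow> u \<noteq> v \<Longrightarrow> \<chi> {u, v} = c"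
      for c and F :: "nat ograph"
    proof -
      obtain f where f: "strict_mono_on (verts F) f" "f ` verts F = R"
        using exists_strict_mono_onto[of "verts F" R] F finR by (auto simp: ordered_graph_def)
      show ?thesis
      proof (rule has_mono_copyI[OF F(1) f(1)])
        show "f ` verts F \<subseteq> {1..N}" using f(2) R(1) by simp
        fix e assume "e \<in> edges F"
        hence "e \<in> nsets (verts F) 2" using F(1) by (auto simp: ordered_graph_def)
        then obtain u v where uv: "e = {u, v}" "u \<in> verts F" "v \<in> verts F" "u \<noteq> v"
          by (auto elim: nsets2_E)
        moreover have "f u \<noteq> f v"
          using strict_mono_on_imp_inj_on[OF f(1)] uv by (auto dest: inj_onD)
        ultimately show "\<chi> (f ` e) = c" using c f(2) by auto
      qed
    qed
    from R(2) show ?thesis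
    proof (elim disjE conjE)
      assume "card R = card (verts G)" "clique R {e. \<chi> e = Red}"
      thus ?thesis using emb[OF G, of Red] by (auto simp: clique_def)
    next
      assume "card R = q" "indep R {e. \<chi> e = Red}"
      moreover from this have "\<chi> {u, v} = Blue" if "u \<in> R" "v \<in> R" "u \<noteq> v" for u v
        using that by (cases "\<chi> {u, v}") (auto simp: indep_def)
      ultimately show ?thesis
        using emb[OF ordered_graph_complete[of q], of Blue] by (auto simp: complete_ograph_def)
    qed
  qed
  thus ?thesis using N(1) by (intro exI[of _ N]) auto
qed

text \<open>If the Ramsey number were at most \<open>N\<close>, the copy that it guarantees for
  \<open>\<chi>\<close> would also be a copy inside \<open>{1..N}\<close>.\<close>

lemma ordered_ramsey_greaterI:
  fixes G :: "nat ograph"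
  assumes G: "ordered_graph G" and "\<not> has_mono_copy N \<chi> Red G"
    and "\<not> has_mono_copy N \<chi> Blue (complete_ograph q)"
  shows "N < ordered_ramsey G (complete_ograph q)"
proof (rule ccontr)
  assume "\<not> N < ordered_ramsey G (complete_ograph q)"
  moreover have "has_mono_copy (ordered_ramsey G (complete_ograph q)) \<chi> Red G \<or>
      has_mono_copy (ordered_ramsey G (complete_ograph q)) \<chi> Blue (complete_ograph q)"
    unfolding ordered_ramsey_def using LeastI_ex[OF exists_ramsey_number[OF G, of q]] by blast
  ultimately show False
    using assms has_mono_copy_mono ordered_graph_complete by (metis not_le)
qed

section \<open>Colouring by blocks\<close>

text \<open>Intended for monotone \<open>g\<close>, where \<open>g x\<close> is the block receiving
  the point \<open>x\<close>: equal values at the two ends of a bin then mean that \<open>g\<close>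
  is constant on it, and \<open>m\<close> marks a bin split between blocks.\<close>

definition bin_block :: "nat \<Rightarrow> nat \<Rightarrow> (nat \<Rightarrow> nat) \<Rightarrow> nat \<Rightarrow> nat" where
  "bin_block m K g i = (if g (i * K) = g (i * K + (K - 1)) then g (i * K) else m)"

lemma bin_block_eq:
  assumes g: "\<And>x y. x \<le> y \<Longrightarrow> y < a \<Longrightarrow> g x \<le> g y" and K: "K > 0"
    and a: "2 * m * K \<le> a" and x: "x div K < 2 * m" "bin_block m K g (x div K) < m"
  shows "g x = bin_block m K g (x div K)"
proof -
  let ?i = "x div K"
  have eq: "g (?i * K) = g (?i * K + (K - 1))" "bin_block m K g ?i = g (?i * K)"
    using x(2) by (auto simp: bin_block_def split: if_splits)
  have "Suc ?i * K \<le> 2 * m * K" using x(1) by (intro mult_right_mono) auto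
  hence last: "?i * K + (K - 1) < a" using K a by simp
  have "x = ?i * K + x mod K" by simp
  moreover have "x mod K \<le> K - 1" using mod_less_divisor[OF K, of x] by linarith
  ultimately have "?i * K \<le> x" "x \<le> ?i * K + (K - 1)" by linarith+
  hence "g (?i * K) \<le> g x" "g x \<le> g (?i * K + (K - 1))" using g last by auto
  thus ?thesis using eq by simp
qed

text \<open>The values of \<open>g\<close> at the starts of split bins increase strictly and stay
  below \<open>m\<close>, so at most \<open>m\<close> of the \<open>2 * m\<close> bins are split.
  The unsplit bins of one block are disjoint \<open>K\<close>-sets in a fibre of at most
  \<open>T * K\<close> points, so there are at most \<open>T\<close> of them.\<close>

lemma admissible_bin_block:
  assumes g: "\<And>x y. x \<le> y \<Longrightarrow> y < a \<Longrightarrow> g x \<le> g y" "\<And>x. x < a \<Longrightarrow> g x < m"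
    and fib: "\<And>y. card {x\<in>{..<a}. g x = y} \<le> T * K"
    and K: "K > 0" and a: "2 * m * K \<le> a"
  shows "admissible m T (bin_block m K g)"
proof -
  let ?\<gamma> = "bin_block m K g" and ?r = "2 * m"
  have bin: "i * K + j < a" if "i < ?r" "j < K" for i j
  proof -
    have "i * K + j < Suc i * K" using that by simp
    also have "\<dots> \<le> ?r * K" using that by (intro mult_right_mono) auto
    finally show ?thesis using a by linarith
  qed
  have le: "?\<gamma> i \<le> m" if "i < ?r" for i
    using g(2)[OF bin[OF that, of 0]] K by (simp add: bin_block_def)
  let ?bad = "{i\<in>{..<?r}. \<not> ?\<gamma> i < m}"
  \<comment> \<open>A split bin ends in a later block than it starts in, and no later bin starts
    before that end.\<close>
  have bad_lt: "g (i * K) < g (i' * K)" if ii: "i \<in> ?bad" "i' \<in> ?bad" "i < i'" for i i'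
  proof -
    have b: "i * K + (K - 1) < a" "i' * K < a" using bin[of i "K - 1"] bin[of i' 0] ii K by auto
    have "g (i * K) \<noteq> g (i * K + (K - 1))"
      using ii(1) g(2)[OF bin[of i 0]] K by (auto simp: bin_block_def)
    moreover have "g (i * K) \<le> g (i * K + (K - 1))" using g(1) b by simp
    moreover have "i * K + (K - 1) \<le> i' * K"
    proof -
      have "Suc i * K \<le> i' * K" using ii(3) by (intro mult_right_mono) auto
      thus ?thesis by simp
    qed
    hence "g (i * K + (K - 1)) \<le> g (i' * K)" using g(1) b by simp
    ultimately show ?thesis by linarith
  qed
  have "inj_on (\<lambda>i. g (i * K)) ?bad"
  proof (rule inj_onI)
    fix i i' assume "i \<in> ?bad" "i' \<in> ?bad" "g (i * K) = g (i' * K)"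
    thus "i = i'" using bad_lt[of i i'] bad_lt[of i' i] by (cases i i' rule: linorder_cases) auto
  qed
  moreover have "(\<lambda>i. g (i * K)) ` ?bad \<subseteq> {..<m}" using g(2) bin[of _ 0] K by auto
  ultimately have "card ?bad \<le> m" using card_inj_on_le[of _ ?bad "{..<m}"] by simp
  moreover have "card ({i\<in>{..<?r}. ?\<gamma> i < m} \<union> ?bad) \<le> card {i\<in>{..<?r}. ?\<gamma> i < m} + card ?bad"
    by (rule card_Un_le)
  moreover have "{i\<in>{..<?r}. ?\<gamma> i < m} \<union> ?bad = {..<?r}" by auto
  ultimately have good: "m \<le> card {i\<in>{..<?r}. ?\<gamma> i < m}" by simp
  have "card {i\<in>{..<?r}. ?\<gamma> i = y} \<le> T" if y: "y < m" for y
  proof -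
    let ?S = "{i\<in>{..<?r}. ?\<gamma> i = y} \<times> {..<K}"
    have "inj_on (\<lambda>(i, j). i * K + j) ?S"
    proof (rule inj_onI, clarsimp)
      fix i j i' j' assume "j < K" "j' < K" "i * K + j = i' * K + j'"
      hence "(i * K + j) div K = (i' * K + j') div K" "(i * K + j) mod K = (i' * K + j') mod K" by (simp_all only:)
      thus "i = i' \<and> j = j'" using \<open>j < K\<close> \<open>j' < K\<close> by simp
    qed
    moreover have "(\<lambda>(i, j). i * K + j) ` ?S \<subseteq> {x\<in>{..<a}. g x = y}"
    proof clarsimp
      fix i j assume ij: "i < ?r" "j < K" "y = ?\<gamma> i"
      have "(i * K + j) div K = i" using ij by simp
      hence "g (i * K + j) = ?\<gamma> i" using bin_block_eq[OF g(1) K a, where x = "i * K + j"] ij y by simp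
      thus "i * K + j < a \<and> g (i * K + j) = ?\<gamma> i" using bin ij by simp
    qed
    ultimately have "card ?S \<le> card {x\<in>{..<a}. g x = y}" by (intro card_inj_on_le) auto
    also have "\<dots> \<le> T * K" by (rule fib)
    finally show ?thesis using K by (simp add: card_cartesian_product)
  qed
  thus ?thesis using le good by (auto simp: admissible_def)
qed

text \<open>The \<open>l\<close> pairs of consecutive vertices in front of the graph of \<open>\<pi>\<close> serve only to raise the
  interval chromatic number from 2 to \<open>l + 2\<close>.\<close>

definition partner :: "nat \<Rightarrow> nat \<Rightarrow> (nat \<Rightarrow> nat) \<Rightarrow> nat \<Rightarrow> nat" where
  "partner l a \<pi> v =
     (if v < 2 * l then if even v then v + 1 else v - 1
      else if v < 2 * l + a then 2 * l + a + \<pi> (v - 2 * l)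
      else 2 * l + inv_into {..<a} \<pi> (v - (2 * l + a)))"

text \<open>Every edge is produced from both of its ends, the form that
  \<open>ordered_matching_of_involution\<close> takes.\<close>

definition bij_matching :: "nat \<Rightarrow> nat \<Rightarrow> (nat \<Rightarrow> nat) \<Rightarrow> nat ograph" where
  "bij_matching l a \<pi> = \<lparr>verts = {..<2 * l + 2 * a}, edges = (\<lambda>v. {v, partner l a \<pi> v}) ` {..<2 * l + 2 * a}\<rparr>"

section \<open>Edges, regularity and interval chromatic number of the matching\<close>

lemma partner_cases:
  assumes \<pi>: "bij_betw \<pi> {..<a} {..<a}" and v: "v < 2 * l + 2 * a"
  obtains (pair) j where "j < l" "{v, partner l a \<pi> v} = {2 * j, 2 * j + 1}"
      "partner l a \<pi> v < 2 * l" "partner l a \<pi> v \<noteq> v" "partner l a \<pi> (partner l a \<pi> v) = v"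
  | (bulk) x where "x < a" "\<pi> x < a" "{v, partner l a \<pi> v} = {2 * l + x, 2 * l + a + \<pi> x}"
      "partner l a \<pi> v < 2 * l + 2 * a" "partner l a \<pi> v \<noteq> v" "partner l a \<pi> (partner l a \<pi> v) = v"
proof -
  have im: "\<pi> x < a" if "x < a" for x using \<pi> that by (auto simp: bij_betw_def)
  have inj: "inj_on \<pi> {..<a}" using \<pi> by (simp add: bij_betw_def)
  consider "v < 2 * l" | "2 * l \<le> v" "v < 2 * l + a" | "2 * l + a \<le> v" by linarith
  thus ?thesis
  proof cases
    case 1
    show ?thesis
    proof (cases "even v")
      case True
      then obtain j where "v = 2 * j" by blast
      thus ?thesis using 1 by (intro pair[of j]) (auto simp: partner_def)
    next
      case False
      then obtain j where "v = 2 * j + 1" by (blast elim: oddE)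
      thus ?thesis using 1 by (intro pair[of j]) (auto simp: partner_def)
    qed
  next
    case 2
    then obtain x where x: "v = 2 * l + x" "x < a" by (metis le_Suc_ex nat_add_left_cancel_less)
    have "partner l a \<pi> v = 2 * l + a + \<pi> x" using x by (simp add: partner_def)
    moreover have "partner l a \<pi> (2 * l + a + \<pi> x) = v"
      using x inj by (simp add: partner_def)
    ultimately show ?thesis using x im[OF x(2)] by (intro bulk[of x]) auto
  next
    case 3
    then obtain y where y: "v = 2 * l + a + y" by (metis le_Suc_ex)
    have ya: "y < a" using v y by simp
    hence "y \<in> \<pi> ` {..<a}" using \<pi> by (simp add: bij_betw_def)
    then obtain x where x: "x < a" "y = \<pi> x" by auto
    have "partner l a \<pi> v = 2 * l + x" using x inj by (simp add: partner_def y)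
    moreover have "partner l a \<pi> (2 * l + x) = v" using x y by (simp add: partner_def)
    ultimately show ?thesis using x y im[OF x(1)] by (intro bulk[of x]) auto
  qed
qed

lemma edges_bij_matching:
  assumes \<pi>: "bij_betw \<pi> {..<a} {..<a}"
  shows "edges (bij_matching l a \<pi>) = (\<lambda>j. {2 * j, 2 * j + 1}) ` {..<l} \<union> (\<lambda>x. {2 * l + x, 2 * l + a + \<pi> x}) ` {..<a}"
    (is "_ = ?R")
proof
  show "edges (bij_matching l a \<pi>) \<subseteq> ?R"
  proof
    fix e assume "e \<in> edges (bij_matching l a \<pi>)"
    then obtain v where v: "v < 2 * l + 2 * a" "e = {v, partner l a \<pi> v}" by (auto simp: bij_matching_def)
    show "e \<in> ?R" by (rule partner_cases[OF \<pi> v(1)]) (use v(2) in auto)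
  qed
  have "{2 * j, 2 * j + 1} = {2 * j, partner l a \<pi> (2 * j)}" if "j < l" for j
    using that by (simp add: partner_def)
  moreover have "{2 * l + x, 2 * l + a + \<pi> x} = {2 * l + x, partner l a \<pi> (2 * l + x)}" if "x < a" for x
    using that by (simp add: partner_def)
  ultimately show "?R \<subseteq> edges (bij_matching l a \<pi>)" by (fastforce simp: bij_matching_def)
qed

lemma ordered_matching_bij_matching:
  assumes \<pi>: "bij_betw \<pi> {..<a} {..<a}"
  shows "ordered_matching (bij_matching l a \<pi>)"
  unfolding bij_matching_def
proof (rule ordered_matching_of_involution)
  fix v assume "v \<in> {..<2 * l + 2 * a}"
  hence v: "v < 2 * l + 2 * a" by simp
  show "partner l a \<pi> v \<in> {..<2 * l + 2 * a}" by (rule partner_cases[OF \<pi> v]) auto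
  show "partner l a \<pi> v \<noteq> v" by (rule partner_cases[OF \<pi> v]) auto
  show "partner l a \<pi> (partner l a \<pi> v) = v" by (rule partner_cases[OF \<pi> v]) auto
qed simp

lemma interval_chromatic_number_bij_matching:
  assumes \<pi>: "bij_betw \<pi> {..<a} {..<a}" and a: "a > 0"
  shows "interval_chromatic_number (bij_matching l a \<pi>) = l + 2"
proof -
  let ?G = "bij_matching l a \<pi>"
  \<comment> \<open>The classes are shifted by one against the front pairs and so cut each of them:
    \<open>{0}\<close>, \<open>{1, 2}\<close>, \<open>{3, 4}\<close> and so on. For
    \<open>l > 0\<close> the vertex \<open>2 * l - 1\<close> joins the left half in class
    \<open>l\<close>; the right half is class \<open>l + 1\<close>.\<close>
  define col where "col = (\<lambda>v. if v < 2 * l then (v + 1) div 2 else if v < 2 * l + a then l else l + 1)"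
  \<comment> \<open>After 0 come the later ends \<open>2 * j - 1\<close> of the front pairs, and
    last the partner of \<open>2 * l\<close>, the first vertex of the left half.\<close>
  define w where "w = (\<lambda>j. if j = 0 then 0 else if j \<le> l then 2 * j - 1 else 2 * l + a + \<pi> 0)"
  have V: "verts ?G = {..<2 * l + 2 * a}" by (simp add: bij_matching_def)
  have \<pi>0: "\<pi> 0 < a" using \<pi> a by (auto simp: bij_betw_def)
  show ?thesis
  proof (rule interval_chromatic_number_eqI[where col = col and w = w])
    show "ordered_graph ?G" using ordered_matching_bij_matching[OF \<pi>] by (simp add: ordered_matching_def)
    show "col u \<le> col v" if "u \<le> v" for u v using that by (auto simp: col_def)
    show "col ` verts ?G = {..<l + 2}"
    proof
      show "col ` verts ?G \<subseteq> {..<l + 2}" by (auto simp: col_def)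
      have "i \<in> col ` verts ?G" if i: "i < l + 2" for i
      proof -
        consider "i < l" | "i = l" | "i = l + 1" using i by linarith
        thus ?thesis
        proof cases
          case 1
          hence "col (2 * i) = i" by (simp add: col_def)
          thus ?thesis using 1 by (intro image_eqI[of _ _ "2 * i"]) (auto simp: V)
        next
          case 2
          hence "col (2 * l) = i" using a by (simp add: col_def)
          thus ?thesis using a by (intro image_eqI[of _ _ "2 * l"]) (auto simp: V)
        next
          case 3
          hence "col (2 * l + a) = i" by (simp add: col_def)
          thus ?thesis using a by (intro image_eqI[of _ _ "2 * l + a"]) (auto simp: V)
        qed
      qed
      thus "{..<l + 2} \<subseteq> col ` verts ?G" by auto
    qed
    show "col u \<noteq> col v" if "{u, v} \<in> edges ?G" for u v
    proof -
      have "(\<exists>j<l. {u, v} = {2 * j, 2 * j + 1}) \<or> (\<exists>x<a. {u, v} = {2 * l + x, 2 * l + a + \<pi> x})"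
        using that by (auto simp: edges_bij_matching[OF \<pi>])
      thus ?thesis by (auto simp: doubleton_eq_iff col_def)
    qed
    show "w j \<in> verts ?G" if "j < l + 2" for j using that \<pi>0 by (auto simp: V w_def)
    show "w i \<le> w j" if "i \<le> j" for i j using that by (auto simp: w_def)
    show "\<exists>u. w j \<le> u \<and> u \<le> w (Suc j) \<and> {u, w (Suc j)} \<in> edges ?G" if "Suc j < l + 2" for j
    proof (cases "j < l")
      case True
      hence "w j \<le> 2 * j" "w (Suc j) = 2 * j + 1" by (auto simp: w_def)
      thus ?thesis using True by (intro exI[of _ "2 * j"]) (auto simp: edges_bij_matching[OF \<pi>])
    next
      case False
      hence "j = l" using that by simp
      hence "w j \<le> 2 * l" "w (Suc j) = 2 * l + a + \<pi> 0" by (auto simp: w_def)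
      thus ?thesis using a by (intro exI[of _ "2 * l"]) (auto simp: edges_bij_matching[OF \<pi>])
    qed
  qed
qed

text \<open>The vertices are cut into \<open>m\<close> blocks of size \<open>T * K\<close>, and an
  edge is blue if its blocks are adjacent in \<open>H\<close>. A blue triangle would project to a
  triangle of \<open>H\<close>. A red copy of the matching would assign blocks to the bins of both
  halves admissibly, and \<open>spread\<close> then finds one of its edges sent to a blue
  pair.\<close>

lemma ordered_ramsey_bij_matching:
  fixes m T K a :: nat
  assumes H: "H \<subseteq> nsets {..<m} 2" "\<And>t. t \<in> triangles {..<m} \<Longrightarrow> \<not> t \<subseteq> H"
    and \<pi>: "bij_betw \<pi> {..<a} {..<a}"
    and spread: "\<And>\<alpha> \<beta>. admissible m T \<alpha> \<Longrightarrow> admissible m T \<beta> \<Longrightarrow>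
       \<exists>x<a. x div K < 2 * m \<and> \<pi> x div K < 2 * m \<and> {\<alpha> (x div K), \<beta> (\<pi> x div K)} \<in> H"
    and K: "K > 0" and T: "T > 0" and a: "2 * m * K \<le> a"
  shows "m * (T * K) < ordered_ramsey (bij_matching l a \<pi>) (complete_ograph 3)"
proof -
  let ?G = "bij_matching l a \<pi>" and ?N = "m * (T * K)"
  \<comment> \<open>Vertices are numbered from 1, so \<open>v - 1\<close> aligns the blocks
    \<open>0\<close> to \<open>m - 1\<close>.\<close>
  define blk where "blk = (\<lambda>v::nat. (v - 1) div (T * K))"
  \<comment> \<open>A pair inside one block has a singleton image under \<open>blk\<close>, which is
    not in \<open>H\<close>, so it is red.\<close>
  define \<chi> where "\<chi> = (\<lambda>e. if blk ` e \<in> H then Blue else Red)"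
  have TK: "T * K > 0" using T K by simp
  have V: "verts ?G = {..<2 * l + 2 * a}" by (simp add: bij_matching_def)
  show ?thesis
  proof (rule ordered_ramsey_greaterI)
    show "ordered_graph ?G" using ordered_matching_bij_matching[OF \<pi>] by (simp add: ordered_matching_def)
    show "\<not> has_mono_copy ?N \<chi> Blue (complete_ograph 3)"
    proof
      assume "has_mono_copy ?N \<chi> Blue (complete_ograph 3)"
      then obtain f where "\<And>e. e \<in> edges (complete_ograph 3) \<Longrightarrow> \<chi> (f ` e) = Blue"
        using has_mono_copyE by metis
      hence f: "\<chi> (f ` e) = Blue" if "e \<in> nsets {1..3} 2" for e using that by (simp add: complete_ograph_def)
      define b where "b = blk \<circ> f"
      have bH: "{b i, b j} \<in> H" if "i \<in> {1..3}" "j \<in> {1..3}" "i \<noteq> j" for i j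
        using f[of "{i, j}"] that by (auto simp: \<chi>_def b_def split: if_splits)
      have b2: "{b i, b j} \<in> nsets {..<m} 2" if "i \<in> {1..3}" "j \<in> {1..3}" "i \<noteq> j" for i j
        using bH[OF that] H(1) by blast
      have "b 1 < m" "b 2 < m" "b 3 < m" "b 1 \<noteq> b 2" "b 2 \<noteq> b 3" "b 1 \<noteq> b 3"
        using b2[of 1 2] b2[of 2 3] b2[of 1 3] by auto
      hence "{b 1, b 2, b 3} \<in> nsets {..<m} 3" by (auto simp: nsets_def)
      hence "nsets {b 1, b 2, b 3} 2 \<in> triangles {..<m}" by (auto simp: triangles_def)
      moreover have "nsets {b 1, b 2, b 3} 2 \<subseteq> H"
        using bH[of 1 2] bH[of 2 3] bH[of 1 3] by (auto simp: nsets_2_eq insert_commute)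
      ultimately show False using H(2) by blast
    qed
    show "\<not> has_mono_copy ?N \<chi> Red ?G"
    proof
      assume "has_mono_copy ?N \<chi> Red ?G"
      then obtain f where f: "strict_mono_on (verts ?G) f" "f ` verts ?G \<subseteq> {1..?N}"
        "\<And>e. e \<in> edges ?G \<Longrightarrow> \<chi> (f ` e) = Red" using has_mono_copyE by metis
      have fN: "1 \<le> f v" "f v \<le> ?N" if "v < 2 * l + 2 * a" for v using f(2) that by (auto simp: V)
      have fmono: "f u \<le> f v" if "u \<le> v" "v < 2 * l + 2 * a" for u v
        using strict_mono_onD[OF f(1), of u v] that by (cases "u = v") (auto simp: V)
      \<comment> \<open>The offset \<open>z\<close> treats both halves at once: \<open>2 * l\<close>
        for the left and \<open>2 * l + a\<close> for the right.\<close>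
      have adm: "admissible m T (bin_block m K (\<lambda>x. blk (f (z + x))))"
        and mono: "\<And>x y. x \<le> y \<Longrightarrow> y < a \<Longrightarrow> blk (f (z + x)) \<le> blk (f (z + y))"
        if z: "z \<le> 2 * l + a" for z
      proof -
        show mono: "\<And>x y. x \<le> y \<Longrightarrow> y < a \<Longrightarrow> blk (f (z + x)) \<le> blk (f (z + y))"
          unfolding blk_def by (intro div_le_mono diff_le_mono fmono) (use z in auto)
        show "admissible m T (bin_block m K (\<lambda>x. blk (f (z + x))))"
        proof (rule admissible_bin_block[OF mono _ _ K a])
          show "blk (f (z + x)) < m" if "x < a" for x
          proof -
            have "f (z + x) - 1 < m * (T * K)" using fN[of "z + x"] z that by linarith
            thus ?thesis unfolding blk_def by (simp only: div_less_iff_less_mult[OF TK])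
          qed
          \<comment> \<open>As \<open>f\<close> is injective on the vertices, a block receives at
            most its own size.\<close>
          show "card {x \<in> {..<a}. blk (f (z + x)) = y} \<le> T * K" for y
          proof -
            have "inj_on (\<lambda>x. f (z + x)) {x \<in> {..<a}. blk (f (z + x)) = y}"
            proof (rule inj_onI)
              fix x x' assume x: "x \<in> {x \<in> {..<a}. blk (f (z + x)) = y}" "x' \<in> {x \<in> {..<a}. blk (f (z + x)) = y}"
                "f (z + x) = f (z + x')"
              show "x = x'"
                using strict_mono_on_imp_inj_on[OF f(1)] x z by (auto simp: V dest!: inj_onD)
            qed
            moreover have "(\<lambda>x. f (z + x)) ` {x \<in> {..<a}. blk (f (z + x)) = y} \<subseteq> {y * (T * K) + 1..<y * (T * K) + 1 + T * K}"
            proof clarsimp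
              fix x assume x: "x < a" "y = blk (f (z + x))"
              have "f (z + x) \<ge> 1" using fN[of "z + x"] x z by linarith
              moreover have "y * (T * K) \<le> f (z + x) - 1" unfolding x(2) blk_def by (rule div_times_less_eq_dividend)
              moreover have "f (z + x) - 1 < y * (T * K) + T * K"
                unfolding x(2) blk_def using dividend_less_div_times[OF TK, of "f (z + x) - 1"] by linarith
              ultimately show "Suc (blk (f (z + x)) * (T * K)) \<le> f (z + x) \<and> f (z + x) < Suc (blk (f (z + x)) * (T * K) + T * K)"
                unfolding x(2)[symmetric] by linarith
            qed
            ultimately have "card {x \<in> {..<a}. blk (f (z + x)) = y} \<le> card {y * (T * K) + 1..<y * (T * K) + 1 + T * K}"
              by (rule card_inj_on_le) simp
            thus ?thesis by simp
          qed
        qed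
      qed
      let ?gA = "\<lambda>x. blk (f (2 * l + x))" and ?gB = "\<lambda>x. blk (f (2 * l + a + x))"
      obtain x where x: "x < a" "x div K < 2 * m" "\<pi> x div K < 2 * m"
        "{bin_block m K ?gA (x div K), bin_block m K ?gB (\<pi> x div K)} \<in> H"
        using spread[OF adm[of "2 * l"] adm[of "2 * l + a"]] by auto
      have "{bin_block m K ?gA (x div K), bin_block m K ?gB (\<pi> x div K)} \<in> nsets {..<m} 2"
        using x(4) H(1) by blast
      hence lt: "bin_block m K ?gA (x div K) < m" "bin_block m K ?gB (\<pi> x div K) < m" by auto
      have "?gA x = bin_block m K ?gA (x div K)"
        by (rule bin_block_eq[OF mono[of "2 * l"] K a x(2) lt(1)]) auto
      moreover have "?gB (\<pi> x) = bin_block m K ?gB (\<pi> x div K)"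
        by (rule bin_block_eq[OF mono[of "2 * l + a"] K a x(3) lt(2)]) auto
      ultimately have "{?gA x, ?gB (\<pi> x)} \<in> H" using x(4) by simp
      hence "\<chi> (f ` {2 * l + x, 2 * l + a + \<pi> x}) = Blue" by (simp add: \<chi>_def)
      moreover have "{2 * l + x, 2 * l + a + \<pi> x} \<in> edges ?G" using x(1) by (auto simp: edges_bij_matching[OF \<pi>])
      ultimately show False using f(3) by fastforce
    qed
  qed
qed

section \<open>Choice of the parameters\<close>

text \<open>\<open>Q\<close> has order \<open>sqrt m\<close>, both \<open>s\<close> and
  \<open>d\<close> have order \<open>sqrt m * ln m\<close>, and \<open>T\<close> has order
  \<open>m / s\<close>. A block then has \<open>9 * d * T \<ge> m\<close> vertices, so the
  \<open>m\<close> blocks have at least \<open>m ^ 2\<close> in total, while the matching needs only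
  order \<open>m * d\<close> vertices.\<close>

lemma exists_matching_ramsey_ge_square:
  obtains C :: real and m0 :: nat where "C \<ge> 1"
    "\<And>m n k. m \<ge> m0 \<Longrightarrow> even n \<Longrightarrow> k \<ge> 2 \<Longrightarrow> real (2 * k) + C * (real m * sqrt (real m) * ln (real m)) \<le> real n \<Longrightarrow>
       \<exists>M :: nat ograph. ordered_matching M \<and> card (verts M) = n \<and> interval_chromatic_number M = k \<and>
         real m ^ 2 \<le> real (ordered_ramsey M (complete_ograph 3))"
proof -
  \<comment> \<open>The constant in the bound on \<open>d\<close>: 2048 comes from
    \<open>Q \<le> 2048 * sqrt m\<close>, 9 from \<open>4 * ln (m + 1) + 1 \<le> 9 * ln m\<close>,
    and the final 1 pays for the ceiling.\<close>
  define D :: real where "D = 256 * 2048 * 9 + 1"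
  \<comment> \<open>This yields \<open>2 * s \<le> m\<close>, so that \<open>T\<close> is not
    rounded down to 0.\<close>
  have "\<forall>\<^sub>F m in sequentially. 128 * 2048 * ln (real m) \<le> sqrt (real m)" by real_asymp
  then obtain m1 where m1: "\<And>m. m \<ge> m1 \<Longrightarrow> 128 * 2048 * ln (real m) \<le> sqrt (real m)"
    by (auto simp: eventually_sequentially)
  have main: "\<exists>M :: nat ograph. ordered_matching M \<and> card (verts M) = n \<and> interval_chromatic_number M = k \<and>
         real m ^ 2 \<le> real (ordered_ramsey M (complete_ograph 3))"
    if m: "m \<ge> max 4 m1" and n: "even n" and k: "k \<ge> 2"
      and le: "real (2 * k) + 36 * D * (real m * sqrt (real m) * ln (real m)) \<le> real n" for m n k :: nat
  proof -
    let ?L = "ln (real m)" and ?R = "sqrt (real m)"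
    \<comment> \<open>\<open>1024 ^ 2 = 2 ^ 20\<close> gives the lower bound required of
      \<open>Q ^ 2\<close>.\<close>
    define Q where "Q = 1024 * nat \<lceil>?R\<rceil>"
    define s where "s = 64 * real Q * ?L"
    define T where "T = nat \<lfloor>real m / (2 * s)\<rfloor>"
    define d where "d = nat \<lceil>256 * real Q * (4 * ln (real m + 1) + 1)\<rceil>"
    define l where "l = k - 2"
    define a where "a = n div 2 - l"
    have m4: "real m \<ge> 4" using m by simp
    have L1: "?L \<ge> 1"
    proof -
      have "exp 1 \<le> real m" using m4 exp_le by linarith
      thus ?thesis using m4 by (simp add: ln_ge_iff)
    qed
    have R1: "?R \<ge> 1" using m4 by simp
    have Qge: "1024 * ?R \<le> real Q" unfolding Q_def using real_nat_ceiling_ge[of ?R] by simp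
    have Qle: "real Q \<le> 2048 * ?R"
    proof -
      have "real (nat \<lceil>?R\<rceil>) \<le> ?R + 1" using R1 by linarith
      moreover have "real Q = 1024 * real (nat \<lceil>?R\<rceil>)" by (simp add: Q_def)
      ultimately show ?thesis using R1 by linarith
    qed
    have Q0: "real Q > 0" using Qge R1 by linarith
    have Q2: "2 ^ 20 * m \<le> Q ^ 2"
    proof -
      have "(1024 * ?R) ^ 2 \<le> real Q ^ 2" using Qge by (intro power_mono) auto
      hence "real (2 ^ 20 * m) \<le> real (Q ^ 2)" by (simp add: power_mult_distrib)
      thus ?thesis by (simp only: of_nat_le_iff)
    qed
    have s0: "s > 0" using Q0 L1 by (simp add: s_def)
    have sm: "2 * s \<le> real m"
    proof -
      have "2 * s \<le> 128 * ((2048 * ?R) * ?L)" unfolding s_def using Qle L1 by simp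
      also have "\<dots> = ?R * (128 * 2048 * ?L)" by simp
      also have "\<dots> \<le> ?R * ?R" using m1[of m] m by (intro mult_left_mono) auto
      finally show ?thesis by simp
    qed
    have Tle: "2 * real T * s \<le> real m"
    proof -
      have "real T \<le> real m / (2 * s)" unfolding T_def using s0 by simp
      thus ?thesis using s0 by (simp add: field_simps)
    qed
    have Tge: "real m / (4 * s) \<le> real T"
    proof -
      have "1 \<le> real m / (2 * s)" using sm s0 by (simp add: field_simps)
      \<comment> \<open>Rounding down a number that is at least 1 loses at most half of it.\<close>
      moreover have "u / 2 \<le> real (nat \<lfloor>u\<rfloor>)" if "1 \<le> u" for u :: real
      proof -
        have "1 \<le> \<lfloor>u\<rfloor>" using that by simp
        moreover from this have "real (nat \<lfloor>u\<rfloor>) = of_int \<lfloor>u\<rfloor>" by simp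
        moreover have "u < of_int \<lfloor>u\<rfloor> + 1" by linarith
        ultimately show ?thesis by linarith
      qed
      ultimately have "real m / (2 * s) / 2 \<le> real T" unfolding T_def by blast
      thus ?thesis by simp
    qed
    hence T0: "T > 0" using m4 s0 by (cases "T = 0") (auto simp: field_simps)
    have dge: "256 * real Q * (4 * ln (real m + 1) + 1) \<le> real d" unfolding d_def by (rule real_nat_ceiling_ge)
    have dge': "1024 * real Q * ?L \<le> real d"
    proof -
      have "?L \<le> ln (real m + 1)" using m4 by simp
      hence "256 * real Q * (4 * ?L) \<le> 256 * real Q * (4 * ln (real m + 1) + 1)"
        by (intro mult_left_mono) auto
      thus ?thesis using dge by linarith
    qed
    have d0: "d > 0"
    proof -
      have "0 < 1024 * real Q * ?L" using Q0 L1 by simp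
      thus ?thesis using dge' by simp
    qed
    have dle: "real d \<le> D * (?R * ?L)"
    proof -
      have "real m + 1 \<le> real m ^ 2"
      proof -
        have "4 * real m \<le> real m * real m" using m4 by (intro mult_right_mono) auto
        thus ?thesis using m4 unfolding power2_eq_square by linarith
      qed
      hence "ln (real m + 1) \<le> ln (real m ^ 2)" using m4 by (subst ln_le_cancel_iff) auto
      also have "\<dots> = 2 * ?L" using m4 by (simp add: ln_realpow)
      finally have "256 * real Q * (4 * ln (real m + 1) + 1) \<le> 256 * (2048 * ?R) * (9 * ?L)"
        using Qle L1 R1 m4 by (intro mult_mono) auto
      moreover have "0 \<le> 256 * real Q * (4 * ln (real m + 1) + 1)" using m4 by simp
      ultimately have "real d \<le> 256 * (2048 * ?R) * (9 * ?L) + 1" unfolding d_def by linarith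
      moreover have "1 * 1 \<le> ?R * ?L" using R1 L1 by (intro mult_mono) auto
      ultimately show ?thesis unfolding D_def by (simp add: algebra_simps)
    qed
    \<comment> \<open>Each of the two halves needs \<open>2 * m\<close> bins of \<open>9 * d\<close>
      vertices; the summand \<open>2 * k\<close> leaves room for the front pairs.\<close>
    have "real (36 * m * d) \<le> 36 * real m * (D * (?R * ?L))"
      using mult_left_mono[OF dle, of "36 * real m"] by simp
    hence "real (2 * k + 36 * m * d) \<le> real n" using le by (simp add: mult_ac)
    hence nge: "2 * k + 36 * m * d \<le> n" by (simp only: of_nat_le_iff)
    have n_eq: "n = 2 * l + 2 * a" using n nge by (auto simp: a_def l_def elim!: evenE)
    have a_ge: "2 * m * (9 * d) \<le> a" using nge k n by (auto simp: a_def l_def elim!: evenE)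
    have a0: "a > 0"
    proof -
      have "0 < 2 * m * (9 * d)" using m d0 by simp
      thus ?thesis using a_ge by linarith
    qed
    obtain H \<pi> where H: "H \<subseteq> nsets {..<m} 2" "\<And>t. t \<in> triangles {..<m} \<Longrightarrow> \<not> t \<subseteq> H"
      and \<pi>: "bij_betw \<pi> {..<a} {..<a}"
      and spread: "\<And>\<alpha> \<beta>. admissible m T \<alpha> \<Longrightarrow> admissible m T \<beta> \<Longrightarrow>
       \<exists>x<a. x div (9 * d) < 2 * m \<and> \<pi> x div (9 * d) < 2 * m \<and> {\<alpha> (x div (9 * d)), \<beta> (\<pi> x div (9 * d))} \<in> H"
      by (rule exists_spreading_bijection[of m Q s T d a]) (use m Q2 Tle dge a_ge in \<open>auto simp: s_def\<close>)
    define M where "M = bij_matching l a \<pi>"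
    have "m * (T * (9 * d)) < ordered_ramsey M (complete_ograph 3)"
      unfolding M_def using d0 T0 a_ge by (intro ordered_ramsey_bij_matching[OF H \<pi> spread]) auto
    hence "real (m * (T * (9 * d))) \<le> real (ordered_ramsey M (complete_ograph 3))"
      by (intro of_nat_mono) simp
    hence "real m ^ 2 \<le> real (ordered_ramsey M (complete_ograph 3))"
    proof (rule order.trans[rotated])
      show "real m ^ 2 \<le> real (m * (T * (9 * d)))"
      proof -
        \<comment> \<open>Since \<open>4 * s = 256 * Q * ?L\<close>, the left side equals
          \<open>36 * m\<close>, more than the block size \<open>m\<close> that is wanted.\<close>
        have "real m / (4 * s) * (9 * (1024 * real Q * ?L)) \<le> real T * (9 * real d)"
          using Tge dge' Q0 L1 by (intro mult_mono) auto
        moreover have "real m / (4 * s) * (9 * (1024 * real Q * ?L)) = 36 * real m"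
          using Q0 L1 by (simp add: s_def)
        ultimately have "real m \<le> real T * (9 * real d)" using m4 by linarith
        hence "real m * real m \<le> real m * (real T * (9 * real d))" by (rule mult_left_mono) simp
        thus ?thesis by (simp add: power2_eq_square)
      qed
    qed
    moreover have "interval_chromatic_number M = k"
      using interval_chromatic_number_bij_matching[OF \<pi> a0, of l] k by (simp add: M_def l_def)
    moreover have "card (verts M) = n" by (simp add: M_def bij_matching_def n_eq)
    moreover have "ordered_matching M" unfolding M_def by (rule ordered_matching_bij_matching[OF \<pi>])
    ultimately show ?thesis by (intro exI[of _ M] conjI)
  qed
  show ?thesis
  proof (rule that)
    show "1 \<le> 36 * D" by (simp add: D_def)
  qed (rule main)
qed

theorem theorem3:
  fixes k :: nat
  assumes "k \<ge> 3"
  shows "\<exists>c::real. c > 0 \<and>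
    (\<forall>\<^sub>F n::nat in sequentially. even n \<longrightarrow>
      (\<exists>M :: nat ograph. ordered_matching M \<and> card (verts M) = n \<and>
         interval_chromatic_number M = k \<and>
         real (ordered_ramsey M (complete_ograph 3)) \<ge> c * (real n / log 2 (real n)) powr (4 / 3)))"
proof -
  obtain C :: real and m0 :: nat where C: "C \<ge> 1" and ex:
    "\<And>m n k. m \<ge> m0 \<Longrightarrow> even n \<Longrightarrow> k \<ge> 2 \<Longrightarrow> real (2 * k) + C * (real m * sqrt (real m) * ln (real m)) \<le> real n \<Longrightarrow>
       \<exists>M :: nat ograph. ordered_matching M \<and> card (verts M) = n \<and> interval_chromatic_number M = k \<and>
         real m ^ 2 \<le> real (ordered_ramsey M (complete_ograph 3))"
    using exists_matching_ramsey_ge_square by metis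
  \<comment> \<open>With \<open>m \<le> \<delta> * y n\<close> this makes
    \<open>C * m powr (3 / 2)\<close> at most half of \<open>n / ln n\<close>, so the bins use at
    most half of the \<open>n\<close> vertices.\<close>
  define \<delta> where "\<delta> = (1 / (2 * C)) powr (2 / 3)"
  have \<delta>0: "\<delta> > 0" using C by (simp add: \<delta>_def)
  have \<delta>1: "\<delta> \<le> 1" unfolding \<delta>_def using C by (intro powr_le1) auto
  have \<delta>C: "\<delta> powr (3 / 2) = 1 / (2 * C)" using C by (simp add: \<delta>_def powr_powr)
  define y where "y = (\<lambda>n::nat. (real n / ln (real n)) powr (2 / 3))"
  have "filterlim y at_top sequentially" unfolding y_def by real_asymp
  \<comment> \<open>If \<open>\<delta> * y n \<ge> m0 + 2\<close>, its floor is at least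
    \<open>m0\<close> and at least half of \<open>\<delta> * y n\<close>.\<close>
  hence ev1: "\<forall>\<^sub>F n in sequentially. (real m0 + 2) / \<delta> \<le> y n" by (simp add: filterlim_at_top)
  have ev2: "\<forall>\<^sub>F n::nat in sequentially. ln (real n) \<ge> 1" by real_asymp
  \<comment> \<open>The other half of the \<open>n\<close> vertices then accommodates
    \<open>2 * k\<close>.\<close>
  have ev3: "\<forall>\<^sub>F n::nat in sequentially. n \<ge> 4 * k + 3" by (rule eventually_ge_at_top)
  have "\<forall>\<^sub>F n::nat in sequentially. even n \<longrightarrow>
      (\<exists>M :: nat ograph. ordered_matching M \<and> card (verts M) = n \<and> interval_chromatic_number M = k \<and>
         real (ordered_ramsey M (complete_ograph 3)) \<ge> \<delta>\<^sup>2 / 4 * (real n / log 2 (real n)) powr (4 / 3))"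
    using ev1 ev2 ev3
  proof eventually_elim
    case (elim n)
    note y_ge = elim(1) and L1 = elim(2) and n_ge = elim(3)
    define m where "m = nat \<lfloor>\<delta> * y n\<rfloor>"
    define x where "x = real n / ln (real n)"
    have yx: "y n = x powr (2 / 3)" by (simp add: y_def x_def)
    have n0: "real n > 0" using n_ge by simp
    have x0: "x > 0" unfolding x_def using n0 L1 by (intro divide_pos_pos) linarith+
    have y\<delta>: "real m0 + 2 \<le> \<delta> * y n" using y_ge \<delta>0 by (simp add: field_simps)
    have m_le: "real m \<le> \<delta> * y n" unfolding m_def using y\<delta> by linarith
    have m_ge: "\<delta> * y n / 2 \<le> real m" unfolding m_def using y\<delta> by linarith
    have m_m0: "m \<ge> m0" unfolding m_def using y\<delta> by linarith
    have m1: "real m \<ge> 1" using m_ge y\<delta> by linarith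
    have y0: "y n \<ge> 0" by (simp add: y_def)
    have m_n: "real m \<le> real n"
    proof -
      have "ln (real n) \<le> real n" using ln_le_minus_one[OF n0] by linarith
      hence "1 \<le> x" unfolding x_def using L1 by (subst le_divide_eq_1_pos) linarith+
      hence "x powr (2 / 3) \<le> x powr 1" by (intro powr_mono) auto
      also have "\<dots> = x" using x0 by simp
      also have "x \<le> real n / 1" unfolding x_def using L1 n0 n_ge by (intro divide_left_mono) auto
      finally have "y n \<le> real n" by (simp add: yx)
      moreover have "\<delta> * y n \<le> 1 * y n" using \<delta>1 y0 by (intro mult_right_mono) auto
      ultimately show ?thesis using m_le by linarith
    qed
    have "real m * sqrt (real m) = real m powr (3 / 2)"
    proof -
      have "real m powr (1 + 1 / 2) = real m * real m powr (1 / 2)" using m1 by (subst powr_add) simp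
      thus ?thesis using m1 by (simp add: powr_half_sqrt)
    qed
    also have "\<dots> \<le> (\<delta> * y n) powr (3 / 2)" using m_le m1 by (intro powr_mono2) auto
    also have "\<dots> = 1 / (2 * C) * x"
      using \<delta>0 y0 x0 by (simp add: powr_mult \<delta>C yx powr_powr)
    finally have "real m * sqrt (real m) \<le> 1 / (2 * C) * x" .
    hence "real m * sqrt (real m) * ln (real m) \<le> (1 / (2 * C) * x) * ln (real n)"
      by (rule mult_mono) (use m1 m_n C x0 in auto)
    also have "\<dots> = real n / (2 * C)" using L1 by (simp add: x_def)
    finally have "C * (real m * sqrt (real m) * ln (real m)) \<le> C * (real n / (2 * C))"
      using C by (intro mult_left_mono) auto
    also have "\<dots> = real n / 2" using C by simp
    finally have le: "real (2 * k) + C * (real m * sqrt (real m) * ln (real m)) \<le> real n"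
      using n_ge by linarith
    have "\<delta>\<^sup>2 / 4 * (real n / log 2 (real n)) powr (4 / 3) \<le> \<delta>\<^sup>2 / 4 * x powr (4 / 3)"
    proof (intro mult_left_mono powr_mono2)
      have "ln (real n) * ln 2 \<le> ln (real n) * 1"
        using L1 ln_2_less_1 by (intro mult_left_mono) auto
      hence "ln (real n) \<le> log 2 (real n)" by (simp add: log_def field_simps)
      thus "real n / log 2 (real n) \<le> x" unfolding x_def using L1 n0 n_ge by (intro divide_left_mono) auto
      show "0 \<le> real n / log 2 (real n)" using L1 by (simp add: log_def)
    qed auto
    also have "\<dots> = (\<delta> * y n / 2) ^ 2"
    proof -
      have "y n ^ 2 = x powr (4 / 3)"
        unfolding yx using x0 by (simp add: power2_eq_square flip: powr_add)
      thus ?thesis by (simp add: power_divide power_mult_distrib)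
    qed
    also have "\<dots> \<le> real m ^ 2" using m_ge \<delta>0 y0 by (intro power_mono) auto
    finally have lower: "\<delta>\<^sup>2 / 4 * (real n / log 2 (real n)) powr (4 / 3) \<le> real m ^ 2" .
    show ?case
    proof
      assume "even n"
      then obtain M :: "nat ograph" where M: "ordered_matching M" "card (verts M) = n" "interval_chromatic_number M = k"
         "real m ^ 2 \<le> real (ordered_ramsey M (complete_ograph 3))"
        using ex[OF m_m0 _ _ le] assms by auto
      thus "\<exists>M :: nat ograph. ordered_matching M \<and> card (verts M) = n \<and> interval_chromatic_number M = k \<and>
         real (ordered_ramsey M (complete_ograph 3)) \<ge> \<delta>\<^sup>2 / 4 * (real n / log 2 (real n)) powr (4 / 3)"
        using M(1-3) order.trans[OF lower M(4)] by (intro exI[of _ M] conjI)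
    qed
  qed
  moreover have "\<delta>\<^sup>2 / 4 > 0" using \<delta>0 by simp
  ultimately show ?thesis by blast
qed

end
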